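(* Let $X\subset\mathbb{C}$ be a continuum such that $X$ is unshielded or $\mathbb{C}\setminus X$ has finitely many components. Then $X$ is locally connected if and only if $\ell^*(X)=0$.
   Context: A continuum is a nonempty compact connected metric space (possibly a single point). For a continuum $X\subset\mathbb{C}$, $X^o$ and $\partial X$ denote its interior and boundary in $\mathbb{C}$. $X$ is unshielded if $X=\partial U_\infty$, where $U_\infty$ is the unbounded component of $\mathbb{C}\setminus X$. A point $x\in\partial X$ is separated from a point $y\in\partial X$ by a subset $C\subset X$ if there is a separation $\partial X\setminus C=A\cup B$, i.e. a decomposition with $\overline{A}\cap B=A\cap\overline{B}=\emptyset$, such that $x\in A$ and $y\in B$. The modified pseudo-fiber $E_x^*$ of $X$ at $x$ is: $E_x^*=\{x\}$ if $x\in X^o$; and, if $x\in\partial X$, $E_x^*$ is the set of points $y\in\partial X$ that cannot be separated from $x$ by any finite set $C\subset\partial X$. The modified fiber (briefly, fiber) $F_x^*$ of $X$ at $x$ is the connected component of $E_x^*$ containing $x$. A fiber of $X$ is a set of the form $F_x^*$ with $x\in X$; fibers of $X$ are again continua in $\mathbb{C}$, so one may speak of fibers of fibers. The local scale of non-local connectedness $\ell^*(X,x)$ of $X$ at $x\in X$ is the least integer $p\geq 0$ such that there exist $k\leq p+1$ and subcontinua $X=N_0\supset N_1\supset\cdots\supset N_k=\{x\}$ such that $N_i$ is a fiber of $N_{i-1}$ for $1\leq i\leq k$; if no such integer exists, $\ell^*(X,x)=\infty$. The (global) scale of non-local connectedness is $\ell^*(X)=\sup\{\ell^*(X,x):x\in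 X\}$. A space is locally connected if at each of its points every neighborhood contains a connected neighborhood of that point. *)

theory Defs
  imports "HOL-Analysis.Analysis"
begin

definition continuum :: "'a::metric_space set \<Rightarrow> bool" where
  "continuum X \<longleftrightarrow> X \<noteq> {} \<and> compact X \<and> connected X"

text \<open>The complement of a compact set in the plane has exactly one unbounded
  component, so the existential quantifier below picks out that component.\<close>

definition unshielded :: "complex set \<Rightarrow> bool" where
  "unshielded X \<longleftrightarrow> (\<exists>U \<in> components (- X). \<not> bounded U \<and> X = frontier U)"

text \<open>The points \<open>x\<close> and \<open>y\<close> lie in \<open>frontier X - C\<close>
  whenever this holds, since \<open>A \<union> B\<close> is that set.\<close>

definition separated_by :: "complex set \<Rightarrow> complex set \<Rightarrow> complex \<Rightarrow> complex \<Rightarrow> bool" where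
  "separated_by X C x y \<longleftrightarrow>
     (\<exists>A B. frontier X - C = A \<union> B \<and> closure A \<inter> B = {} \<and> A \<inter> closure B = {} \<and>
            x \<in> A \<and> y \<in> B)"

text \<open>Only meaningful for \<open>x \<in> X\<close> with \<open>X\<close> closed, where the second case is
  \<open>x \<in> frontier X\<close>.\<close>

definition pseudo_fiber :: "complex set \<Rightarrow> complex \<Rightarrow> complex set" where
  "pseudo_fiber X x =
     (if x \<in> interior X then {x}
      else {y \<in> frontier X. \<not> (\<exists>C. finite C \<and> C \<subseteq> frontier X \<and> separated_by X C x y)})"

definition fiber :: "complex set \<Rightarrow> complex \<Rightarrow> complex set" where
  "fiber X x = connected_component_set (pseudo_fiber X x) x"

definition is_fiber_of :: "complex set \<Rightarrow> complex set \<Rightarrow> bool" where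
  "is_fiber_of N X \<longleftrightarrow> (\<exists>x\<in>X. N = fiber X x)"

definition fiber_chain :: "complex set \<Rightarrow> complex \<Rightarrow> nat \<Rightarrow> (nat \<Rightarrow> complex set) \<Rightarrow> bool" where
  "fiber_chain X x k N \<longleftrightarrow>
     N 0 = X \<and> N k = {x} \<and> (\<forall>i\<le>k. continuum (N i)) \<and>
     (\<forall>i<k. N (Suc i) \<subseteq> N i \<and> is_fiber_of (N (Suc i)) (N i))"

definition local_scale :: "complex set \<Rightarrow> complex \<Rightarrow> enat" where
  "local_scale X x =
     (if \<exists>p k N. k \<le> p + 1 \<and> fiber_chain X x k N
      then enat (LEAST p. \<exists>k N. k \<le> p + 1 \<and> fiber_chain X x k N)
      else \<infinity>)"

definition global_scale :: "complex set \<Rightarrow> enat" where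
  "global_scale X = (SUP x\<in>X. local_scale X x)"

end

theory Submission
  imports Defs
begin

text \<open>
  Since a fiber always contains its base point, the scale of \<open>X\<close> vanishes exactly when every fiber of
  \<open>X\<close> is a single point.  Under either hypothesis \<open>frontier X\<close> is the union of the frontiers of
  finitely many components \<open>U\<close> of the complement, and each of these frontiers is a continuum.  Strips
  \<open>a < Re (u * z) < b\<close> bounded by two parallel lines are the test regions throughout.

  Trivial fibers imply local connectedness.  If some \<open>frontier U\<close> is not locally connected, infinitely
  many disjoint subcontinua of it cross a common strip (\<open>infinitely_many_crossings\<close>).  A
  subsequence has as upper limit a nondegenerate continuum with a point \<open>x\<close> that no finite set
  separates from any other of its points, because all but finitely many of the crossing continua
  avoid the finite set (\<open>limit_continuum_inseparable\<close>).  So the fiber at \<open>x\<close> is not a point.  Local connectedness then passes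
  from the finitely many frontiers to their union and from \<open>frontier X\<close> to \<open>X\<close>.

  Local connectedness implies trivial fibers.  The planar input is a form of the nonplanarity of
  \<open>K\<^sub>3\<^sub>,\<^sub>3\<close>: three disjoint continua crossing a strip have a middle one, so they cannot be linked inside
  the strip pairwise, each pair away from the third (\<open>no_three_linked_crossings\<close>).  It yields two facts
  for a locally connected \<open>X\<close>: a component \<open>U\<close> of the complement is cut by a strip into pieces of
  which only finitely many come near a line inside the strip (\<open>finite_regions_near_line\<close>), and
  \<open>frontier U\<close> is locally connected (\<open>Torhorst\<close>).

  Given distinct points \<open>x\<close>, \<open>y\<close> of \<open>frontier X\<close>, take the strip bounded by the lines through \<open>x\<close> and
  \<open>y\<close> perpendicular to the segment between them, and a line \<open>\<ell>\<close> in the middle.  The part of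
  \<open>frontier X\<close> on \<open>\<ell>\<close> is covered by the closures of finitely many pieces of the complement.  Running
  along \<open>\<ell>\<close> one can pass from one end to the other through regions of the strip off \<open>frontier X\<close>,
  consecutive regions touching in a point of \<open>frontier X\<close> on \<open>\<ell>\<close>; finitely many such points \<open>C\<close>
  suffice (\<open>chain_along_line\<close>).  A continuum in \<open>frontier X - C\<close> from \<open>x\<close> to \<open>y\<close> would have to meet
  this chain, so \<open>C\<close> separates \<open>x\<close> from \<open>y\<close> (\<open>finite_separator\<close>).
\<close>

section \<open>Continua that must meet\<close>

text \<open>
  A neighbourhood of a continuum is connected and open, hence path connected; projecting the path back
  onto the convex set \<open>R\<close> keeps it close to the continuum because the projection is \<open>1\<close>-Lipschitz
  and fixes \<open>Y\<close>.
\<close>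

lemma path_near_continuum:
  fixes Y :: "'a::euclidean_space set"
  assumes "connected Y" "Y \<subseteq> R" "closed R" "convex R" "p \<in> Y" "q \<in> Y" "0 < e"
  obtains g where "path g" "pathstart g = p" "pathfinish g = q" "path_image g \<subseteq> R"
    "\<And>t. t \<in> path_image g \<Longrightarrow> \<exists>y\<in>Y. dist t y < e"
proof -
  define N where "N = {x + y |x y. x \<in> Y \<and> y \<in> ball 0 e}"
  have N: "x \<in> N \<longleftrightarrow> (\<exists>y\<in>Y. dist x y < e)" for x
    unfolding N_def mem_Collect_eq
    by (metis add_diff_cancel_left' diff_add_cancel add.commute dist_norm mem_ball_0)
  have "N = (\<Union>y\<in>Y. ball y e)"
    by (auto simp: N dist_commute)
  then have "open N"
    by auto
  moreover have "connected N"
  proof -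
    have "N = (\<lambda>(x, y). x + y) ` (Y \<times> ball 0 e)"
      unfolding N_def by (force simp: image_iff)
    then show ?thesis
      using assms by (simp only: case_prod_unfold) (intro connected_continuous_image continuous_intros
          connected_Times convex_connected[OF convex_ball])
  qed
  moreover have "p \<in> N" "q \<in> N"
    using assms by (force simp: N)+
  ultimately obtain f where f: "path f" "path_image f \<subseteq> N" "pathstart f = p" "pathfinish f = q"
    by (meson connected_open_path_connected path_connected_def)
  have "R \<noteq> {}"
    using assms by auto
  define g where "g = closest_point R \<circ> f"
  have fixR: "closest_point R x = x" if "x \<in> Y" for x
    using that assms closest_point_self by blast
  show thesis
  proof
    show "path g"
      unfolding g_def using f \<open>R \<noteq> {}\<close> assms
      by (intro path_continuous_image continuous_on_closest_point)
    show "pathstart g = p" "pathfinish g = q"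
      using f fixR assms by (auto simp: g_def pathstart_compose pathfinish_compose)
    show "path_image g \<subseteq> R"
      using closest_point_in_set[OF assms(3) \<open>R \<noteq> {}\<close>] by (auto simp: g_def path_image_compose)
    show "\<exists>y\<in>Y. dist t y < e" if t: "t \<in> path_image g" for t
    proof -
      obtain x where x: "x \<in> N" "t = closest_point R x"
        using t f(2) by (auto simp: g_def path_image_compose)
      then obtain y where y: "y \<in> Y" "dist x y < e"
        using N by blast
      have "dist (closest_point R x) (closest_point R y) \<le> dist x y"
        using closest_point_lipschitz assms \<open>R \<noteq> {}\<close> by blast
      then show ?thesis
        using x y fixR by (metis le_less_trans)
    qed
  qed
qed

text \<open>
  The Fashoda meeting theorem is about paths.  Disjoint compact sets have positive distance, so disjoint
  continua could be replaced by nearby disjoint paths with the same endpoints.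
\<close>

lemma continua_crossing_box_meet:
  fixes Y Z :: "complex set"
  assumes Y: "compact Y" "connected Y" "Y \<subseteq> cbox a b" "y0 \<in> Y" "Im y0 = Im a" "y1 \<in> Y" "Im y1 = Im b"
    and Z: "compact Z" "connected Z" "Z \<subseteq> cbox a b" "z0 \<in> Z" "Re z0 = Re a" "z1 \<in> Z" "Re z1 = Re b"
  shows "Y \<inter> Z \<noteq> {}"
proof
  assume "Y \<inter> Z = {}"
  then obtain d where d: "d > 0" "\<And>y z. y \<in> Y \<Longrightarrow> z \<in> Z \<Longrightarrow> d \<le> dist y z"
    using separate_compact_closed[of Y Z] Y(1) Z(1) compact_imp_closed by blast
  obtain g where g: "path g" "pathstart g = y0" "pathfinish g = y1" "path_image g \<subseteq> cbox a b"
      "\<And>t. t \<in> path_image g \<Longrightarrow> \<exists>y\<in>Y. dist t y < d/2"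
    using path_near_continuum[of Y "cbox a b" y0 y1 "d/2"] Y d by auto
  obtain f where f: "path f" "pathstart f = z0" "pathfinish f = z1" "path_image f \<subseteq> cbox a b"
      "\<And>t. t \<in> path_image f \<Longrightarrow> \<exists>z\<in>Z. dist t z < d/2"
    using path_near_continuum[of Z "cbox a b" z0 z1 "d/2"] Z d by auto
  define \<phi> :: "complex \<Rightarrow> real^2" where "\<phi> z = (\<chi> i. if i = 1 then Re z else Im z)" for z
  have \<phi>1: "\<phi> z $ 1 = Re z" and \<phi>2: "\<phi> z $ 2 = Im z" for z
    by (auto simp: \<phi>_def)
  have cont: "continuous_on S \<phi>" for S
  proof -
    have "continuous_on S (\<lambda>z. if i = 1 then Re z else Im z)" for i :: 2
      by (cases "i = 1") (auto intro!: continuous_intros)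
    then show ?thesis
      unfolding \<phi>_def by (intro continuous_on_vec_lambda)
  qed
  have inj: "\<phi> z = \<phi> w \<Longrightarrow> z = w" for z w
    by (metis \<phi>1 \<phi>2 complex_eqI)
  have box: "\<phi> z \<in> cbox (\<phi> a) (\<phi> b)" if "z \<in> cbox a b" for z
    using that by (auto simp: mem_box_cart forall_2 \<phi>1 \<phi>2 in_cbox_complex_iff)
  have "path (\<phi> \<circ> f)" "path (\<phi> \<circ> g)"
    using f g cont by (auto intro!: path_continuous_image)
  moreover have "path_image (\<phi> \<circ> f) \<subseteq> cbox (\<phi> a) (\<phi> b)" "path_image (\<phi> \<circ> g) \<subseteq> cbox (\<phi> a) (\<phi> b)"
    using f g box by (auto simp: path_image_compose)
  moreover have "pathstart (\<phi> \<circ> f) $ 1 = \<phi> a $ 1" "pathfinish (\<phi> \<circ> f) $ 1 = \<phi> b $ 1"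
     "pathstart (\<phi> \<circ> g) $ 2 = \<phi> a $ 2" "pathfinish (\<phi> \<circ> g) $ 2 = \<phi> b $ 2"
    using f g Y Z by (auto simp: pathstart_compose pathfinish_compose \<phi>1 \<phi>2)
  ultimately obtain w where "w \<in> path_image (\<phi> \<circ> f)" "w \<in> path_image (\<phi> \<circ> g)"
    using fashoda by blast
  then obtain s t where "s \<in> path_image f" "t \<in> path_image g" "\<phi> s = \<phi> t"
    by (auto simp: path_image_compose)
  then have "s \<in> path_image f" "s \<in> path_image g"
    using inj by auto
  then obtain y z where "y \<in> Y" "dist s y < d/2" "z \<in> Z" "dist s z < d/2"
    using f g by blast
  then show False
    using d(2)[of y z] dist_triangle_half_r[of s y d z] by fastforce
qed

text \<open>
  Both continua are prolonged to the left of the strip by segments, so that \<open>Y\<close> runs from the bottom to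
  the top of a box and \<open>Z\<close> from its left to its right side.
\<close>

lemma continua_interlaced_in_strip_meet:
  fixes Y Z :: "complex set"
  assumes Y: "compact Y" "connected Y" "\<And>w. w \<in> Y \<Longrightarrow> a \<le> Re w \<and> Re w \<le> b"
      "p \<in> Y" "Re p = a" "q \<in> Y" "Re q = a"
    and Z: "compact Z" "connected Z" "\<And>w. w \<in> Z \<Longrightarrow> a \<le> Re w \<and> Re w \<le> b"
      "s \<in> Z" "Re s = a" "t \<in> Z" "Re t = b"
    and order: "Im p < Im s" "Im s < Im q"
  shows "Y \<inter> Z \<noteq> {}"
proof
  assume disj: "Y \<inter> Z = {}"
  have "bounded (Y \<union> Z)"
    using Y Z compact_imp_bounded by auto
  then obtain T where T: "\<And>w. w \<in> Y \<union> Z \<Longrightarrow> norm w \<le> T"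
    unfolding bounded_iff by blast
  have ImT: "\<bar>Im w\<bar> \<le> T" if "w \<in> Y \<union> Z" for w
    using T[OF that] abs_Im_le_cmod[of w] by linarith
  define p1 p2 q1 q2 s1 where "p1 = Complex (a-1) (Im p)" "p2 = Complex (a-1) (-T)"
    "q1 = Complex (a-1) (Im q)" "q2 = Complex (a-1) T" "s1 = Complex (a-2) (Im s)"
  note defs = p1_p2_q1_q2_s1_def
  define Y' where "Y' = closed_segment p2 p1 \<union> (closed_segment p1 p \<union> (Y \<union> (closed_segment q q1 \<union> closed_segment q1 q2)))"
  define Z' where "Z' = closed_segment s1 s \<union> Z"
  have seg: "Re w \<in> closed_segment (Re c) (Re d) \<and> Im w \<in> closed_segment (Im c) (Im d)"
    if "w \<in> closed_segment c d" for c d w :: complex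
    using that by (auto simp: closed_segment_def)
  have "Y' \<inter> Z' \<noteq> {}"
  proof (rule continua_crossing_box_meet[where a = "Complex (a-2) (-T)" and b = "Complex b T"
        and ?y0.0 = p2 and ?y1.0 = q2 and ?z0.0 = s1 and ?z1.0 = t])
    show "compact Y'" "compact Z'"
      unfolding Y'_def Z'_def using Y Z by (intro compact_Un compact_segment; simp)+
    show "connected Y'"
      unfolding Y'_def using Y
      by (intro connected_Un connected_segment) auto
    show "connected Z'"
      unfolding Z'_def using Z
      by (intro connected_Un connected_segment) auto
    have bb: "a \<le> b"
      using Z by fastforce
    have "\<bar>Im p\<bar> \<le> T" "\<bar>Im q\<bar> \<le> T" "\<bar>Im s\<bar> \<le> T"
      using ImT Y Z by auto
    then show "Y' \<subseteq> cbox (Complex (a-2) (-T)) (Complex b T)"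
      unfolding Y'_def in_cbox_complex_iff subset_iff
      using ImT Y bb
      by (auto dest!: seg simp: defs closed_segment_eq_real_ivl in_cbox_complex_iff split: if_splits) (force dest!: ImT)+
    show "Z' \<subseteq> cbox (Complex (a-2) (-T)) (Complex b T)"
      unfolding Z'_def in_cbox_complex_iff subset_iff
      using ImT Z bb \<open>\<bar>Im s\<bar> \<le> T\<close>
      by (auto dest!: seg simp: defs closed_segment_eq_real_ivl in_cbox_complex_iff split: if_splits) (force dest!: ImT)+
  qed (use Z in \<open>auto simp: Y'_def Z'_def defs\<close>)
  then obtain w where w: "w \<in> Y'" "w \<in> Z'"
    by blast
  show False
  proof (cases "w \<in> Z")
    case True
    then have "w \<notin> Y" "a \<le> Re w"
      using disj Z by auto
    then have "w = p \<or> w = q"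
      using w(1) Y order unfolding Y'_def
      by (auto dest!: seg simp: defs closed_segment_eq_real_ivl complex_eq_iff split: if_splits)
    then show False
      using \<open>w \<notin> Y\<close> Y by auto
  next
    case False
    then have wseg: "Im w = Im s" "Re w \<le> a" "w \<noteq> s"
      using w(2) Z unfolding Z'_def
      by (auto dest!: seg simp: defs closed_segment_eq_real_ivl split: if_splits)
    then have "Re w < a"
      using Z(5) by (metis complex_eqI order_le_imp_less_or_eq)
    then have "w \<notin> Y"
      using Y(3) by force
    then show False
      using w(1) Y order wseg \<open>Re w < a\<close> ImT[of p] ImT[of q] unfolding Y'_def
      by (auto dest!: seg simp: defs closed_segment_eq_real_ivl split: if_splits)
  qed
qed

text \<open>
  The factor \<open>u\<close>, usually of norm \<open>1\<close>, only chooses a direction: \<open>Re (u * z)\<close> is a coordinate across a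
  strip bounded by two parallel lines, and \<open>Im (u * z)\<close> the coordinate along it.
\<close>

definition crosses :: "complex \<Rightarrow> real \<Rightarrow> real \<Rightarrow> complex set \<Rightarrow> bool" where
  "crosses u a b Q \<longleftrightarrow> compact Q \<and> connected Q \<and> (\<forall>z\<in>Q. a \<le> Re (u * z) \<and> Re (u * z) \<le> b) \<and>
     (\<exists>z\<in>Q. Re (u * z) = a) \<and> (\<exists>z\<in>Q. Re (u * z) = b)"

text \<open>
  Order the three continua by the points where they touch one side of the strip.  Linking the outer two
  away from the middle one would give a continuum interlaced with the middle one.
\<close>

lemma no_three_linked_crossings:
  assumes "u \<noteq> 0" and I: "card I = 3"
    and Q: "\<And>i. i \<in> I \<Longrightarrow> crosses u a b (Q i)"
    and disj: "\<And>i j. \<lbrakk>i \<in> I; j \<in> I; i \<noteq> j\<rbrakk> \<Longrightarrow> Q i \<inter> Q j = {}"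
    and link: "\<And>i j k. \<lbrakk>i \<in> I; j \<in> I; k \<in> I; i \<noteq> j; j \<noteq> k; i \<noteq> k\<rbrakk> \<Longrightarrow>
      \<exists>T. compact T \<and> connected T \<and> (\<forall>z\<in>T. a \<le> Re (u * z) \<and> Re (u * z) \<le> b) \<and>
          T \<inter> Q i \<noteq> {} \<and> T \<inter> Q k \<noteq> {} \<and> T \<inter> Q j = {}"
  shows False
proof -
  have "\<forall>i\<in>I. \<exists>z. z \<in> Q i \<and> Re (u * z) = a"
    using Q unfolding crosses_def by blast
  then obtain s where s: "\<And>i. i \<in> I \<Longrightarrow> s i \<in> Q i \<and> Re (u * s i) = a"
    by metis
  have ne: "Im (u * s i) \<noteq> Im (u * s j)" if "i \<in> I" "j \<in> I" "i \<noteq> j" for i j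
  proof
    assume "Im (u * s i) = Im (u * s j)"
    then have "u * s i = u * s j"
      using s that by (metis complex_eqI)
    then show False
      using \<open>u \<noteq> 0\<close> s[OF that(1)] s[OF that(2)] disj[OF that] by (metis IntI empty_iff mult_cancel_left)
  qed
  obtain i j k where ijk: "I = {i,j,k}" "i \<noteq> j" "j \<noteq> k" "i \<noteq> k"
    using I by (auto simp: card_3_iff)
  have *: False if ijk: "i \<in> I" "j \<in> I" "k \<in> I" "Im (u * s i) < Im (u * s j)" "Im (u * s j) < Im (u * s k)" for i j k
  proof -
    have ne': "i \<noteq> j" "j \<noteq> k" "i \<noteq> k"
      using that by auto
    obtain T where T: "compact T" "connected T" "\<forall>z\<in>T. a \<le> Re (u * z) \<and> Re (u * z) \<le> b"
          "T \<inter> Q i \<noteq> {}" "T \<inter> Q k \<noteq> {}" "T \<inter> Q j = {}"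
      using link[OF ijk(1-3) ne'] by blast
    define Y where "Y = Q i \<union> (T \<union> Q k)"
    note Qs = Q[OF ijk(1)] Q[OF ijk(2)] Q[OF ijk(3)]
    obtain t where t: "t \<in> Q j" "Re (u * t) = b"
      using Qs by (auto simp: crosses_def)
    have "(*) u ` Y \<inter> (*) u ` Q j \<noteq> {}"
    proof (rule continua_interlaced_in_strip_meet[where a = a and b = b and p = "u * s i" and q = "u * s k"
         and s = "u * s j" and t = "u * t"])
      show "compact ((*) u ` Y)" "compact ((*) u ` Q j)"
        using Qs T by (auto simp: Y_def crosses_def intro!: compact_continuous_image continuous_intros)
      have "connected Y"
        unfolding Y_def using Qs T by (intro connected_Un) (auto simp: crosses_def)
      then show "connected ((*) u ` Y)" "connected ((*) u ` Q j)"
        using Qs by (auto simp: crosses_def intro!: connected_continuous_image continuous_intros)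
    qed (use Qs T s t that in \<open>auto simp: Y_def crosses_def simp del: times_complex.sel\<close>)
    then have "Y \<inter> Q j \<noteq> {}"
      using \<open>u \<noteq> 0\<close> by auto
    then show False
      using T disj[OF ijk(1,2)] disj[OF ijk(3,2)] ne' by (auto simp: Y_def)
  qed
  show False
    using ne[of i j] ne[of j k] ne[of i k] *[of i j k] *[of i k j] *[of j i k] *[of j k i] *[of k i j] *[of k j i]
      ijk by (auto simp del: times_complex.sel) linarith+
qed

section \<open>Continua that are not locally connected\<close>

text \<open>
  Boundary bumping, with the set cut off at a level of \<open>f\<close>.
\<close>

lemma component_reaches_level:
  fixes f :: "'a::metric_space \<Rightarrow> real"
  assumes Z: "compact Z" "connected Z" and f: "continuous_on Z f"
    and z: "z0 \<in> Z" "a \<le> f z0" "z1 \<in> Z" "f z1 \<le> a"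
  defines "D \<equiv> connected_component_set (Z \<inter> {z. a \<le> f z}) z0"
  shows "compact D" "\<exists>z\<in>D. f z = a"
proof -
  define S where "S = Z \<inter> {z. a \<le> f z}"
  have S: "closedin (top_of_set Z) S"
  proof -
    have "S = Z \<inter> f -` {a..}"
      by (auto simp: S_def)
    then show ?thesis
      using continuous_closedin_preimage[OF f] by auto
  qed
  have "compact S"
    using S Z closedin_compact by blast
  have DS: "D = connected_component_set S z0"
    by (simp add: D_def S_def)
  have "closedin (top_of_set S) D"
    unfolding DS by (rule closedin_connected_component)
  then show "compact D"
    using \<open>compact S\<close> closedin_compact by blast
  show "\<exists>z\<in>D. f z = a"
  proof (cases "S = Z")
    case True
    then have "D = Z"
      using Z z connected_component_eq_self by (metis DS)
    moreover have "z1 \<in> S"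
      using True z by simp
    then have "a \<le> f z1"
      by (simp add: S_def)
    ultimately show ?thesis
      using z by (intro bexI[of _ z1]) auto
  next
    case False
    have "D \<in> connected_components_of (subtopology (top_of_set Z) S)"
    proof -
      have "D = connected_component_of_set (top_of_set S) z0"
        unfolding DS by (auto simp: connected_component_of_def connected_component_def connectedin_subtopology)
      then show ?thesis
        using z S_def by (auto simp: connected_components_of_def subtopology_subtopology Int_absorb1)
    qed
    then have "D \<inter> top_of_set Z frontier_of S \<noteq> {}"
      using Z S False by (intro boundary_bumping_theorem_closed)
        (auto simp: connected_space_subtopology compact_space_subtopology Hausdorff_space_subtopology)
    then obtain z where z: "z \<in> D" "z \<in> top_of_set Z frontier_of S"
      by blast
    have "z \<in> S"
      using z(1) connected_component_subset DS by blast
    have "f z = a"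
    proof (rule ccontr)
      assume "f z \<noteq> a"
      then have fz: "z \<in> Z" "a < f z"
        using \<open>z \<in> S\<close> by (auto simp: S_def)
      have "openin (top_of_set Z) (Z \<inter> f -` {a<..})"
        using continuous_openin_preimage_gen[OF f] by auto
      then have "Z \<inter> f -` {a<..} \<subseteq> top_of_set Z interior_of S"
        by (intro interior_of_maximal) (auto simp: S_def)
      then have "z \<in> top_of_set Z interior_of S"
        using fz by auto
      then show False
        using z by (simp add: frontier_of_def)
    qed
    then show ?thesis
      using z by blast
  qed
qed

lemma crossing_subcontinuum:
  assumes Z: "compact Z" "connected Z" "z0 \<in> Z" "Re (u * z0) \<le> a" "z1 \<in> Z" "b \<le> Re (u * z1)" "a < b"
  obtains Q where "Q \<subseteq> Z" "crosses u a b Q"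
proof -
  have cont: "continuous_on S (\<lambda>z. Re (u * z))" "continuous_on S (\<lambda>z. - Re (u * z))" for S
    by (intro continuous_intros)+
  define D where "D = connected_component_set (Z \<inter> {z. a \<le> Re (u * z)}) z1"
  have D: "compact D" "\<exists>z\<in>D. Re (u * z) = a"
    unfolding D_def using assms by (intro component_reaches_level[where ?z1.0 = z0] cont; simp)+
  have "z1 \<in> D" "connected D" "D \<subseteq> Z" "\<And>z. z \<in> D \<Longrightarrow> a \<le> Re (u * z)"
    unfolding D_def using assms connected_component_subset[of "Z \<inter> {z. a \<le> Re (u * z)}" z1]
    by (auto simp del: times_complex.sel)
  note D = D this
  obtain z2 where z2: "z2 \<in> D" "Re (u * z2) = a"
    using D by blast
  define Q where "Q = connected_component_set (D \<inter> {z. - b \<le> - Re (u * z)}) z2"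
  have Q: "compact Q" "\<exists>z\<in>Q. - Re (u * z) = - b"
    unfolding Q_def using assms z2 D by (intro component_reaches_level[where ?z1.0 = z1] cont; simp)+
  have "z2 \<in> Q" "connected Q" "Q \<subseteq> D" "\<And>z. z \<in> Q \<Longrightarrow> Re (u * z) \<le> b"
    unfolding Q_def using assms z2 connected_component_subset[of "D \<inter> {z. - b \<le> - Re (u * z)}" z2]
    by (auto simp del: times_complex.sel)
  then have "Q \<subseteq> Z" "crosses u a b Q"
    using Q D z2 by (auto simp: crosses_def simp del: times_complex.sel)
  then show thesis
    using that by blast
qed

lemma crosses_nonempty: "crosses u a b Q \<Longrightarrow> Q \<noteq> {}"
  by (auto simp: crosses_def)

text \<open>
  At a point \<open>x\<close> where local connectedness fails there is a square around \<open>x\<close> such that points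
  arbitrarily close to \<open>x\<close> lie in components of \<open>K\<close> within the square that miss \<open>x\<close>.  These components
  are infinitely many, since each stays at a positive distance from \<open>x\<close>, and each reaches the
  boundary of the square.  Infinitely many of them reach the same side.
\<close>

lemma infinitely_many_crossings:
  fixes K :: "complex set"
  assumes K: "compact K" "connected K" and nlc: "\<not> locally connected K"
  obtains u a b \<Q> where "norm u = 1" "a < b" "infinite \<Q>" "pairwise disjnt \<Q>"
    "\<And>Q. Q \<in> \<Q> \<Longrightarrow> Q \<subseteq> K \<and> crosses u a b Q"
proof -
  obtain v x where v: "openin (top_of_set K) v" "x \<in> v"
    and bad: "\<And>w. \<lbrakk>openin (top_of_set K) w; x \<in> w; w \<subseteq> v\<rbrakk> \<Longrightarrow>
      \<exists>y\<in>w. \<not> (\<exists>c. connected c \<and> c \<subseteq> v \<and> x \<in> c \<and> y \<in> c)"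
    using nlc unfolding locally_connected_im_kleinen by meson
  obtain e where e: "e > 0" "\<And>y. y \<in> K \<Longrightarrow> dist y x < e \<Longrightarrow> y \<in> v"
    using v unfolding openin_euclidean_subtopology_iff by blast
  \<comment> \<open>small enough for the square of half side \<open>r\<close> around \<open>x\<close> to lie in the disc of radius \<open>e\<close>\<close>
  define r where "r = e / 3"
  \<comment> \<open>negative maximum norm: the squares around \<open>x\<close> are its superlevel sets\<close>
  define g where "g z = - max \<bar>Re (z - x)\<bar> \<bar>Im (z - x)\<bar>" for z
  have contg: "continuous_on S g" for S
    unfolding g_def by (intro continuous_intros)
  define B where "B = K \<inter> {z. - r \<le> g z}"
  define D where "D y = connected_component_set B y" for y
  have r: "r > 0"
    using e by (simp add: r_def)
  have xK: "x \<in> K"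
    using v openin_imp_subset by blast
  have gdist: "- dist z x \<le> g z" for z
    unfolding g_def dist_norm using abs_Re_le_cmod[of "z - x"] abs_Im_le_cmod[of "z - x"] by linarith
  have Bv: "B \<subseteq> v"
  proof
    fix z assume z: "z \<in> B"
    have "dist z x \<le> \<bar>Re (z - x)\<bar> + \<bar>Im (z - x)\<bar>"
      unfolding dist_norm by (rule cmod_le)
    also have "\<dots> \<le> 2 * r"
      using z by (auto simp: B_def g_def)
    also have "\<dots> < e"
      using e by (simp add: r_def)
    finally show "z \<in> v"
      using e z by (auto simp: B_def)
  qed
  have near: "\<exists>y\<in>K. dist y x < \<delta> \<and> dist y x < r / 3 \<and> x \<notin> D y" if "\<delta> > 0" for \<delta>
  proof -
    define w where "w = K \<inter> ball x (min \<delta> (r / 3))"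
    have "openin (top_of_set K) w" "x \<in> w"
      using that r xK by (auto simp: w_def)
    moreover have "w \<subseteq> v"
      using e by (auto simp: w_def r_def dist_commute)
    ultimately obtain y where y: "y \<in> w" "\<not> (\<exists>c. connected c \<and> c \<subseteq> v \<and> x \<in> c \<and> y \<in> c)"
      using bad by blast
    have "x \<notin> D y"
    proof
      assume "x \<in> D y"
      then have "connected (D y)" "D y \<subseteq> v" "y \<in> D y"
        using Bv connected_component_subset[of B y] connected_component_in(1)[of B y x]
        by (auto simp: D_def connected_component_refl_eq)
      then show False
        using y \<open>x \<in> D y\<close> by blast
    qed
    then show ?thesis
      using y by (auto simp: w_def dist_commute)
  qed
  define \<D> where "\<D> = D ` {y \<in> K. dist y x < r / 3 \<and> x \<notin> D y}"
  have inB: "y \<in> B" if "y \<in> K" "dist y x < r / 3" for y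
    using that gdist[of y] r by (auto simp: B_def)
  have far: "\<exists>z\<in>K. g z \<le> - r"
  proof (rule ccontr)
    assume "\<not> ?thesis"
    then have "B = K"
      by (auto simp: B_def)
    then show False
      using near[of 1] K xK connected_component_eq_self by (auto simp: D_def)
  qed
  have compD: "compact (D y)" "\<exists>z\<in>D y. g z = - r" if "y \<in> K" "dist y x < r / 3" for y
    using component_reaches_level[OF K contg] inB[OF that] far that unfolding D_def B_def by auto
  have "infinite \<D>"
  proof
    assume "finite \<D>"
    then have "compact (\<Union>\<D>)"
      using compD by (intro compact_Union) (auto simp: \<D>_def)
    moreover have "x \<notin> \<Union>\<D>"
      by (auto simp: \<D>_def)
    ultimately obtain \<delta> where \<delta>: "\<delta> > 0" "\<And>y. y \<in> \<Union>\<D> \<Longrightarrow> \<delta> \<le> dist x y"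
      by (meson compact_imp_closed separate_point_closed)
    obtain y where y: "y \<in> K" "dist y x < \<delta>" "dist y x < r / 3" "x \<notin> D y"
      using near[OF \<delta>(1)] by blast
    have "y \<in> D y"
      using inB[OF y(1,3)] by (simp add: D_def)
    then have "y \<in> \<Union>\<D>"
      using y by (auto simp: \<D>_def)
    then have "\<delta> \<le> dist x y"
      using \<delta>(2) by blast
    then show False
      using y(2) by (simp add: dist_commute)
  qed
  define touches where "touches u = {E \<in> \<D>. \<exists>z\<in>E. Re (u * (z - x)) = r}" for u
  have "\<D> \<subseteq> (\<Union>u\<in>{1,-1,\<i>,-\<i>}. touches u)"
  proof
    fix E assume E: "E \<in> \<D>"
    then obtain z where z: "z \<in> E" "g z = - r"
      using compD by (force simp: \<D>_def)
    then have "Re (z - x) = r \<or> - Re (z - x) = r \<or> Im (z - x) = r \<or> - Im (z - x) = r"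
      unfolding g_def by (simp add: max_def abs_if split: if_splits; linarith)
    then have "\<exists>u\<in>{1,-1,\<i>,-\<i>}. Re (u * (z - x)) = r"
      by auto
    then show "E \<in> (\<Union>u\<in>{1,-1,\<i>,-\<i>}. touches u)"
      using E z unfolding touches_def by blast
  qed
  then obtain u where u: "u \<in> {1,-1,\<i>,-\<i>}" "infinite (touches u)"
    using \<open>infinite \<D>\<close> by (meson finite.emptyI finite.insertI finite_UN_I finite_subset)
  then have normu: "norm u = 1"
    by auto
  define a where "a = Re (u * x) + r / 3"
  define b where "b = Re (u * x) + r"
  have "a < b"
    using r by (simp add: a_def b_def)
  have "\<exists>Q. Q \<subseteq> E \<and> crosses u a b Q" if E: "E \<in> touches u" for E
  proof -
    obtain y z where yz: "y \<in> K" "dist y x < r / 3" "E = D y" "z \<in> E" "Re (u * (z - x)) = r"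
      using E unfolding touches_def \<D>_def by blast
    have "y \<in> E" "connected E" "compact E"
      using inB[OF yz(1,2)] compD[OF yz(1,2)] yz(3) by (auto simp: D_def)
    moreover have "Re (u * (y - x)) \<le> norm (u * (y - x))"
      by (rule complex_Re_le_cmod)
    moreover have "norm (u * (y - x)) = dist y x"
      using normu by (simp add: norm_mult dist_norm)
    moreover have "Re (u * (y - x)) = Re (u * y) - Re (u * x)"
      by (simp add: algebra_simps)
    ultimately have "y \<in> E" "connected E" "compact E" "Re (u * y) \<le> a"
      using yz(2) unfolding a_def by linarith+
    moreover have "b \<le> Re (u * z)"
      using yz(5) by (simp add: b_def algebra_simps)
    ultimately show ?thesis
      using crossing_subcontinuum[of E y u a z b] yz(4) \<open>a < b\<close> by metis
  qed
  then obtain q where q: "\<And>E. E \<in> touches u \<Longrightarrow> q E \<subseteq> E \<and> crosses u a b (q E)"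
    by metis
  have disj: "E \<inter> E' = {}" if "E \<in> touches u" "E' \<in> touches u" "E \<noteq> E'" for E E'
  proof -
    have "\<D> \<subseteq> components B"
      using inB by (auto simp: \<D>_def D_def intro: componentsI)
    then show ?thesis
      using that components_nonoverlap[of E B E'] by (auto simp: touches_def)
  qed
  have disjq: "q E \<inter> q E' = {}" if "E \<in> touches u" "E' \<in> touches u" "E \<noteq> E'" for E E'
    using disj[OF that] q that by blast
  have "inj_on q (touches u)"
    using disjq q crosses_nonempty by (metis inf.idem inj_onI)
  then have "infinite (q ` touches u)"
    using u finite_image_iff by blast
  moreover have "pairwise disjnt (q ` touches u)"
    using disjq by (auto simp: pairwise_def disjnt_def)
  moreover have "Q \<subseteq> K \<and> crosses u a b Q" if "Q \<in> q ` touches u" for Q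
  proof -
    have "E \<subseteq> K" if "E \<in> touches u" for E
      using that connected_component_subset unfolding touches_def \<D>_def D_def B_def by blast
    then show ?thesis
      using that q by blast
  qed
  ultimately show thesis
    using that[OF normu, of a b "q ` touches u"] r by (simp add: a_def b_def)
qed

text \<open>
  Choose a sequence of the given continua with points on one side of the strip converging to \<open>x\<close>, and
  let \<open>L\<close> be the upper limit of the sequence.  It is connected because the continua eventually come
  close to \<open>x\<close>.  A finite set meets only finitely many of them; every other one is a connected set in
  the complement of the finite set which comes close to \<open>x\<close>, and infinitely many of these come close
  to a given point of \<open>L\<close>.
\<close>

lemma limit_continuum_inseparable:
  assumes K: "compact K" and ab: "a < b" and inf: "infinite \<Q>" and disj: "pairwise disjnt \<Q>"
    and \<Q>: "\<And>Q. Q \<in> \<Q> \<Longrightarrow> Q \<subseteq> K \<and> crosses u a b Q"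
  obtains x y L where "connected L" "L \<subseteq> K" "x \<in> L" "y \<in> L" "x \<noteq> y"
    "\<And>X C w. \<lbrakk>finite C; K \<subseteq> frontier X; w \<in> L\<rbrakk> \<Longrightarrow> \<not> separated_by X C x w"
proof -
  obtain Q0 :: "nat \<Rightarrow> complex set" where Q0: "inj Q0" "range Q0 \<subseteq> \<Q>"
    using inf infinite_countable_subset by blast
  have "\<forall>n. \<exists>s. s \<in> Q0 n \<and> Re (u * s) = a"
    using Q0 \<Q> unfolding crosses_def by (meson rangeI subsetD)
  then obtain s0 where s0: "\<And>n. s0 n \<in> Q0 n \<and> Re (u * s0 n) = a"
    by metis
  have "\<And>n. s0 n \<in> K"
    using s0 Q0 \<Q> by (meson rangeI subsetD)
  then obtain x r where x: "x \<in> K" "strict_mono r" "(s0 \<circ> r) \<longlonglongrightarrow> x"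
    using K unfolding compact_def by metis
  define R where "R n = Q0 (r n)" for n
  define s where "s n = s0 (r n)" for n
  have s: "s \<longlonglongrightarrow> x" "\<And>n. s n \<in> R n" "\<And>n. Re (u * s n) = a"
  proof -
    have "s = s0 \<circ> r"
      by (auto simp: s_def)
    then show "s \<longlonglongrightarrow> x"
      using x(3) by simp
  qed (use s0 in \<open>simp_all only: s_def R_def\<close>)
  have R: "R n \<subseteq> K" "crosses u a b (R n)" "connected (R n)" for n
    using Q0 \<Q> by (auto simp: R_def crosses_def image_subset_iff)
  have "inj R"
    using Q0 x(2) unfolding R_def by (metis (mono_tags, lifting) injD injI strict_mono_eq)
  then have Rdisj: "R m \<inter> R n = {}" if "m \<noteq> n" for m n
    using disj that Q0 unfolding pairwise_def disjnt_def R_def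
    by (metis injD rangeI subsetD R_def)
  \<comment> \<open>the upper limit of the sequence \<open>R\<close>\<close>
  define L where "L = {w. \<forall>e>0. \<exists>\<^sub>F n in sequentially. \<exists>z\<in>R n. dist z w < e}"
  have subseq_in_L: "w \<in> L" if q: "strict_mono q" "\<And>n. t n \<in> R (q n)" "t \<longlonglongrightarrow> w" for q t w
    unfolding L_def
  proof (intro CollectI allI impI)
    fix e :: real assume "e > 0"
    then obtain N where N: "\<And>n. n \<ge> N \<Longrightarrow> dist (t n) w < e"
      using q(3) unfolding lim_sequentially by blast
    show "\<exists>\<^sub>F n in sequentially. \<exists>z\<in>R n. dist z w < e"
      unfolding frequently_sequentially
    proof
      fix m
      have "q (max m N) \<ge> m"
        using seq_suble[OF q(1), of "max m N"] by linarith
      moreover have "dist (t (max m N)) w < e"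
        using N by simp
      ultimately show "\<exists>n\<ge>m. \<exists>z\<in>R n. dist z w < e"
        using q(2) by blast
    qed
  qed
  have xL: "x \<in> L"
    using subseq_in_L[of id s] s by (auto simp: strict_mono_def)
  have limit_point: "\<exists>w\<in>M. w \<in> L" if "compact M" "\<exists>\<^sub>F n in sequentially. R n \<inter> M \<noteq> {}" for M
  proof -
    have "infinite {n. R n \<inter> M \<noteq> {}}"
      using that(2) by (simp add: cofinite_eq_sequentially[symmetric] frequently_cofinite)
    then obtain q :: "nat \<Rightarrow> nat" where q: "strict_mono q" "\<And>n. q n \<in> {n. R n \<inter> M \<noteq> {}}"
      using infinite_enumerate by blast
    then have "\<forall>n. \<exists>t. t \<in> R (q n) \<and> t \<in> M"
      by blast
    then obtain t where t: "\<And>n. t n \<in> R (q n) \<and> t n \<in> M"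
      by metis
    then obtain w p where "w \<in> M" "strict_mono p" "(t \<circ> p) \<longlonglongrightarrow> w"
      using \<open>compact M\<close> unfolding compact_def by metis
    moreover have "w \<in> L"
      using subseq_in_L[of "q \<circ> p" "t \<circ> p" w] calculation q t by (auto simp: strict_mono_o)
    ultimately show ?thesis
      by blast
  qed
  have meets: "\<exists>\<^sub>F n in sequentially. R n \<inter> V \<noteq> {}" if V: "open V" "w \<in> L" "w \<in> V" for V w
  proof -
    obtain e where e: "e > 0" "ball w e \<subseteq> V"
      using V open_contains_ball by blast
    then have "\<exists>\<^sub>F n in sequentially. \<exists>z\<in>R n. dist z w < e"
      using V by (simp add: L_def)
    then show ?thesis
    proof (rule frequently_elim1)
      fix n assume "\<exists>z\<in>R n. dist z w < e"
      then show "R n \<inter> V \<noteq> {}"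
        using e by (auto simp: dist_commute subset_iff)
    qed
  qed
  have eventually_near_x: "\<forall>\<^sub>F n in sequentially. s n \<in> V" if "open V" "x \<in> V" for V
    using s(1) that by (rule topological_tendstoD)
  have LK: "L \<subseteq> K"
  proof
    fix w assume w: "w \<in> L"
    show "w \<in> K"
    proof (rule ccontr)
      assume "w \<notin> K"
      then have "\<exists>\<^sub>F n in sequentially. R n \<inter> - K \<noteq> {}"
        using meets[of "- K" w] w K by (auto simp: compact_imp_closed open_Compl)
      moreover have "R n \<inter> - K = {}" for n
        using R(1) by blast
      ultimately show False
        by simp
    qed
  qed
  have "closed L"
  proof -
    have "w \<in> L" if w: "w \<in> closure L" for w
      unfolding L_def
    proof (intro CollectI allI impI)
      fix e :: real assume "e > 0"
      then obtain y where "y \<in> L" "dist y w < e"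
        using w closure_approachable by blast
      then have "\<exists>\<^sub>F n in sequentially. R n \<inter> ball w e \<noteq> {}"
        by (intro meets) (auto simp: dist_commute)
      then show "\<exists>\<^sub>F n in sequentially. \<exists>z\<in>R n. dist z w < e"
        by (rule frequently_elim1) (auto simp: dist_commute)
    qed
    then show ?thesis
      by (meson closure_subset_eq subsetI)
  qed
  have "connected L"
    unfolding connected_closed_set[OF \<open>closed L\<close>]
  proof
    assume "\<exists>A B. closed A \<and> closed B \<and> A \<noteq> {} \<and> B \<noteq> {} \<and> A \<union> B = L \<and> A \<inter> B = {}"
    then obtain A B where AB: "closed A" "closed B" "B \<noteq> {}" "A \<union> B = L" "A \<inter> B = {}" "x \<in> A"
      using xL by (smt (verit) Un_iff inf_commute sup_commute)
    obtain U V where UV: "open U" "open V" "A \<subseteq> U" "B \<subseteq> V" "U \<inter> V = {}"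
      using separation_normal[of A B] AB by auto
    have "\<not> (\<exists>\<^sub>F n in sequentially. R n \<inter> (K - (U \<union> V)) \<noteq> {})"
    proof -
      have "compact (K - (U \<union> V))"
        using K UV by (intro compact_diff open_Un)
      moreover have "w \<notin> L" if "w \<in> K - (U \<union> V)" for w
        using that UV AB by blast
      ultimately show ?thesis
        using limit_point by blast
    qed
    then have "\<forall>\<^sub>F n in sequentially. R n \<subseteq> U \<union> V"
      unfolding not_frequently by (rule eventually_mono) (use R in blast)
    moreover have "\<forall>\<^sub>F n in sequentially. s n \<in> U"
      using eventually_near_x UV AB by blast
    ultimately have "\<forall>\<^sub>F n in sequentially. R n \<inter> V = {}"
    proof eventually_elim
      case (elim n)
      then show ?case
        using connectedD[OF R(3)[of n], of U V] UV s(2)[of n] by blast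
    qed
    moreover obtain w where "w \<in> B"
      using AB by blast
    then have "\<exists>\<^sub>F n in sequentially. R n \<inter> V \<noteq> {}"
      using meets UV AB by blast
    ultimately show False
      by (simp add: frequently_def)
  qed
  moreover obtain y where "y \<in> L" "Re (u * y) = b"
  proof -
    have "compact (K \<inter> {z. Re (u * z) = b})"
      using K by (intro compact_Int_closed closed_Collect_eq continuous_intros)
    moreover have "R n \<inter> (K \<inter> {z. Re (u * z) = b}) \<noteq> {}" for n
      using R[of n] unfolding crosses_def by blast
    ultimately show thesis
      using limit_point that by (metis (mono_tags, lifting) IntD2 frequently_const_iff frequently_elim1 mem_Collect_eq sequentially_bot)
  qed
  moreover have "x \<noteq> y"
  proof -
    have "(\<lambda>n. Re (u * s n)) \<longlonglongrightarrow> Re (u * x)"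
      using s(1) by (intro tendsto_intros)
    then have "Re (u * x) = a"
      by (simp only: s(3) LIMSEQ_const_iff)
    then show ?thesis
      using \<open>Re (u * y) = b\<close> ab by auto
  qed
  moreover have "\<not> separated_by X C x w" if C: "finite C" and KX: "K \<subseteq> frontier X" and w: "w \<in> L" for X C w
  proof
    assume "separated_by X C x w"
    then obtain A B where AB: "frontier X - C = A \<union> B" "closure A \<inter> B = {}" "A \<inter> closure B = {}" "x \<in> A" "w \<in> B"
      by (auto simp: separated_by_def)
    have "finite {n. R n \<inter> C \<noteq> {}}"
    proof -
      have "\<forall>n\<in>{n. R n \<inter> C \<noteq> {}}. \<exists>c\<in>C. c \<in> R n"
        by auto
      then obtain c where "\<forall>n\<in>{n. R n \<inter> C \<noteq> {}}. c n \<in> C \<and> c n \<in> R n"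
        using bchoice[of "{n. R n \<inter> C \<noteq> {}}" "\<lambda>n z. z \<in> C \<and> z \<in> R n"] by blast
      then have c: "\<And>n. R n \<inter> C \<noteq> {} \<Longrightarrow> c n \<in> C \<and> c n \<in> R n"
        by blast
      then have "inj_on c {n. R n \<inter> C \<noteq> {}}"
        using Rdisj by (intro inj_onI) (metis (mono_tags, lifting) disjoint_iff mem_Collect_eq)
      moreover have "c ` {n. R n \<inter> C \<noteq> {}} \<subseteq> C"
        using c by auto
      ultimately show ?thesis
        using C finite_imageD finite_subset by blast
    qed
    then have "\<forall>\<^sub>F n in sequentially. R n \<inter> C = {}"
      by (simp add: cofinite_eq_sequentially[symmetric] eventually_cofinite)
    moreover have "\<forall>\<^sub>F n in sequentially. s n \<in> - closure B"
      using AB by (intro eventually_near_x) auto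
    ultimately have "\<forall>\<^sub>F n in sequentially. R n \<inter> - closure A = {}"
    proof eventually_elim
      case (elim n)
      then have "R n \<subseteq> A \<union> B"
        using AB R(1)[of n] KX by blast
      moreover have "A \<subseteq> closure A" "B \<subseteq> closure B"
        by (auto simp: closure_subset)
      ultimately have "closure A \<inter> R n = {} \<or> closure B \<inter> R n = {}"
        using AB by (intro connected_closedD R(3)) auto
      then show ?case
        using \<open>R n \<subseteq> A \<union> B\<close> elim s(2)[of n] \<open>A \<subseteq> closure A\<close> \<open>B \<subseteq> closure B\<close> by blast
    qed
    moreover have "\<exists>\<^sub>F n in sequentially. R n \<inter> - closure A \<noteq> {}"
      using AB w by (intro meets) auto
    ultimately show False
      by (simp add: frequently_def)
  qed
  ultimately show thesis
    using that[of L x y] LK xL by blast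
qed

section \<open>Regions of a strip\<close>

(* Keeps Re (u * z) intact as the coordinate across a strip. *)
declare times_complex.sel [simp del]

lemma height_lipschitz:
  assumes "norm u = 1"
  shows "\<bar>Re (u * z) - Re (u * w)\<bar> \<le> dist z w"
proof -
  have "\<bar>Re (u * (z - w))\<bar> \<le> norm (u * (z - w))"
    by (rule abs_Re_le_cmod)
  moreover have "norm (u * (z - w)) = dist z w"
    using assms by (simp add: norm_mult dist_norm)
  moreover have "Re (u * (z - w)) = Re (u * z) - Re (u * w)"
    by (simp add: algebra_simps)
  ultimately show ?thesis
    by linarith
qed

lemma finite_if_all_equal:
  assumes "\<And>x y. \<lbrakk>x \<in> A; y \<in> A\<rbrakk> \<Longrightarrow> x = y"
  shows "finite A"
proof (cases "A = {}")
  case False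
  then obtain x where "x \<in> A"
    by blast
  then have "A \<subseteq> {x}"
    using assms by blast
  then show ?thesis
    using finite_subset by blast
qed auto

lemma crosses_intermediate:
  assumes "crosses u a b Q" "a \<le> c" "c \<le> b"
  obtains z where "z \<in> Q" "Re (u * z) = c"
proof -
  have "connected ((\<lambda>z. Re (u * z)) ` Q)"
    using assms by (intro connected_continuous_image continuous_intros) (auto simp: crosses_def)
  moreover have "a \<in> (\<lambda>z. Re (u * z)) ` Q" "b \<in> (\<lambda>z. Re (u * z)) ` Q"
    using assms unfolding crosses_def by blast+
  ultimately have "c \<in> (\<lambda>z. Re (u * z)) ` Q"
    using assms(2,3) unfolding connected_iff_interval by blast
  then show thesis
    using that by blast
qed

definition strip :: "complex \<Rightarrow> real \<Rightarrow> real \<Rightarrow> complex set" where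
  "strip u a b = {z. a < Re (u * z) \<and> Re (u * z) < b}"

lemma mem_strip: "z \<in> strip u a b \<longleftrightarrow> a < Re (u * z) \<and> Re (u * z) < b"
  by (simp add: strip_def)

lemma open_strip: "open (strip u a b)"
  unfolding strip_def by (intro open_Collect_conj open_Collect_less continuous_intros)

lemma component_subset_component:
  assumes "W \<in> components S" "connected T" "T \<subseteq> S" "T \<inter> W \<noteq> {}"
  shows "T \<subseteq> W"
  using assms components_maximal by blast

lemma connected_neighbourhood:
  assumes "locally connected X" "p \<in> X" "0 < e"
  obtains N d where "0 < d" "d \<le> e" "connected N" "N \<subseteq> X \<inter> ball p e" "X \<inter> ball p d \<subseteq> N"
proof -
  have "openin (top_of_set X) (X \<inter> ball p e)" "p \<in> X \<inter> ball p e"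
    using assms by auto
  then obtain N where N: "openin (top_of_set X) N" "connected N" "p \<in> N" "N \<subseteq> X \<inter> ball p e"
    using assms(1) unfolding locally_connected by meson
  then obtain d where "d > 0" "X \<inter> ball p d \<subseteq> N"
    unfolding openin_contains_ball by (metis Int_commute)
  then show thesis
    using that[of "min d e" N] N assms by (auto simp: subset_iff)
qed

text \<open>
  Infinitely many disjoint crossing regions would accumulate at a point \<open>q\<close> of \<open>X\<close> on the middle line.
  A connected neighbourhood of \<open>q\<close> in \<open>X\<close> then links any two of three such regions without entering
  the third: from a point of a region close to \<open>q\<close>, go straight to the nearest point of \<open>X\<close>.
\<close>

lemma finite_crossing_regions:
  assumes X: "compact X" "locally connected X" and u: "norm u = 1"
    and ab: "\<alpha> < a" "a < b" "b < \<beta>"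
  shows "finite {W \<in> components (strip u \<alpha> \<beta> - X).
                  (\<exists>z\<in>W. Re (u * z) \<le> a) \<and> (\<exists>z\<in>W. b \<le> Re (u * z))}"
    (is "finite ?\<W>")
proof (rule ccontr)
  let ?S = "strip u \<alpha> \<beta>"
  define \<W> where "\<W> = ?\<W>"
  assume "infinite ?\<W>"
  then have inf: "infinite \<W>"
    by (simp add: \<W>_def)
  have "closed X"
    using X compact_imp_closed by blast
  have "open (?S - X)"
    using open_strip \<open>closed X\<close> by blast
  have comp: "W \<in> components (?S - X)" "open W" "connected W" "W \<subseteq> ?S - X" if "W \<in> \<W>" for W
  proof -
    show *: "W \<in> components (?S - X)"
      using that by (simp add: \<W>_def)
    show "open W" "connected W" "W \<subseteq> ?S - X"
      using open_components[OF \<open>open (?S - X)\<close> *] in_components_connected[OF *] in_components_subset[OF *]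
      by blast+
  qed
  have disj: "W = W'" if "W \<in> \<W>" "W' \<in> \<W>" "z \<in> W" "z \<in> W'" for W W' z
    using comp(1)[OF that(1)] comp(1)[OF that(2)] that(3,4) components_nonoverlap by blast
  have "\<exists>Q. Q \<subseteq> W \<and> crosses u a b Q" if W: "W \<in> \<W>" for W
  proof -
    obtain z0 z1 where z: "z0 \<in> W" "Re (u * z0) \<le> a" "z1 \<in> W" "b \<le> Re (u * z1)"
      using W unfolding \<W>_def by blast
    obtain g where g: "path g" "path_image g \<subseteq> W" "pathstart g = z0" "pathfinish g = z1"
      using connected_open_path_connected[OF comp(2,3)[OF W]] z unfolding path_connected_def by blast
    obtain Q where "Q \<subseteq> path_image g" "crosses u a b Q"
    proof (rule crossing_subcontinuum[of "path_image g" z0 u a z1 b])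
      show "z0 \<in> path_image g" "z1 \<in> path_image g"
        using g by auto
    qed (use g z ab compact_path_image connected_path_image in auto)
    then show ?thesis
      using g by blast
  qed
  then obtain Q where Q: "\<And>W. W \<in> \<W> \<Longrightarrow> Q W \<subseteq> W \<and> crosses u a b (Q W)"
    by metis
  define c where "c = (a + b) / 2"
  have cab: "a \<le> c" "c \<le> b"
    using ab by (auto simp: c_def)
  have "\<exists>p. p \<in> Q W \<and> Re (u * p) = c" if "W \<in> \<W>" for W
    using crosses_intermediate[of u a b "Q W" c] Q[OF that] cab by metis
  then obtain p where p: "\<And>W. W \<in> \<W> \<Longrightarrow> p W \<in> Q W \<and> Re (u * p W) = c"
    by metis
  have pW: "p W \<in> W" if "W \<in> \<W>" for W
    using p Q that by blast
  obtain M where M: "\<And>z. z \<in> X \<Longrightarrow> norm z \<le> M"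
    using X compact_imp_bounded bounded_iff by metis
  \<comment> \<open>each end of the strip beyond \<open>X\<close> is convex and lies in a single region\<close>
  have fin: "finite {W \<in> \<W>. M < s * Im (u * p W)}" if s: "\<bar>s\<bar> = 1" for s
  proof -
    define H where "H = {z. \<alpha> < Re (u * z) \<and> Re (u * z) < \<beta> \<and> M < s * Im (u * z)}"
    have lin: "linear (\<lambda>z. Re (u * z))" "linear (\<lambda>z. s * Im (u * z))"
      by (auto intro!: linearI simp: algebra_simps)
    have "H = ((\<lambda>z. Re (u * z)) -` {\<alpha><..<\<beta>}) \<inter> ((\<lambda>z. s * Im (u * z)) -` {M<..})"
      by (auto simp: H_def)
    then have "convex H"
      using lin by (auto intro!: convex_Int convex_linear_vimage)
    then have "connected H"
      by (rule convex_connected)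
    moreover have "H \<subseteq> ?S - X"
    proof
      fix z assume z: "z \<in> H"
      have "s * Im (u * z) \<le> \<bar>Im (u * z)\<bar>"
        using s abs_ge_self[of "s * Im (u * z)"] by (simp add: abs_mult)
      also have "\<dots> \<le> norm (u * z)"
        by (rule abs_Im_le_cmod)
      finally show "z \<in> ?S - X"
        using z M[of z] u by (auto simp: H_def mem_strip norm_mult)
    qed
    ultimately have "H \<subseteq> W" if "W \<in> \<W>" "p W \<in> H" for W
      using component_subset_component[OF comp(1)[OF that(1)]] pW[OF that(1)] that(2) by blast
    moreover have "p W \<in> H" if "W \<in> \<W>" "M < s * Im (u * p W)" for W
      using that(2) p[OF that(1)] cab ab by (auto simp: H_def)
    ultimately have "W = W'" if "W \<in> {W \<in> \<W>. M < s * Im (u * p W)}" "W' \<in> {W \<in> \<W>. M < s * Im (u * p W)}" for W W'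
      using that disj pW by blast
    then show ?thesis
      by (rule finite_if_all_equal)
  qed
  define \<V> where "\<V> = {W \<in> \<W>. \<bar>Im (u * p W)\<bar> \<le> M}"
  have "\<W> \<subseteq> \<V> \<union> {W \<in> \<W>. M < 1 * Im (u * p W)} \<union> {W \<in> \<W>. M < (-1) * Im (u * p W)}"
    unfolding \<V>_def by (auto simp: abs_le_iff)
  moreover have "finite {W \<in> \<W>. M < 1 * Im (u * p W)}" "finite {W \<in> \<W>. M < (-1) * Im (u * p W)}"
    by (rule fin, simp)+
  ultimately have "infinite \<V>"
    using inf by (meson finite_Un finite_subset)
  have \<V>: "W \<in> \<W>" if "W \<in> \<V>" for W
    using that by (simp add: \<V>_def)
  have injp: "inj_on p \<V>"
    using disj pW \<V> by (metis inj_onI)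
  have "bounded (p ` \<V>)"
    unfolding bounded_iff
  proof (intro exI ballI)
    fix z assume "z \<in> p ` \<V>"
    then obtain W where W: "W \<in> \<V>" "z = p W"
      by blast
    have "norm z = norm (u * z)"
      using u by (simp add: norm_mult)
    also have "\<dots> \<le> \<bar>Re (u * z)\<bar> + \<bar>Im (u * z)\<bar>"
      by (rule cmod_le)
    also have "\<dots> \<le> \<bar>c\<bar> + M"
      using W p[OF \<V>[OF W(1)]] by (simp add: \<V>_def)
    finally show "norm z \<le> \<bar>c\<bar> + M" .
  qed
  moreover have "infinite (p ` \<V>)"
    using \<open>infinite \<V>\<close> injp finite_imageD by blast
  ultimately obtain q where q: "q islimpt p ` \<V>"
    using bounded_infinite_imp_islimpt[of "p ` \<V>" "p ` \<V>"] by blast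
  have near: "infinite {W \<in> \<V>. dist q (p W) < e}" if "e > 0" for e
  proof
    assume "finite {W \<in> \<V>. dist q (p W) < e}"
    then have "finite (p ` {W \<in> \<V>. dist q (p W) < e})"
      by blast
    moreover have "p ` {W \<in> \<V>. dist q (p W) < e} = p ` \<V> \<inter> ball q e"
      by auto
    ultimately show False
      using q that unfolding islimpt_eq_infinite_ball by metis
  qed
  have "Re (u * q) = c"
  proof -
    have "closed {z. Re (u * z) = c}"
      by (intro closed_Collect_eq continuous_intros)
    moreover have "p ` \<V> \<subseteq> {z. Re (u * z) = c}"
      using p \<V> by blast
    ultimately show ?thesis
      using q by (metis (mono_tags, lifting) closed_limpt islimpt_subset mem_Collect_eq)
  qed
  define e where "e = (b - a) / 4"
  have "e > 0"
    using ab by (simp add: e_def)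
  have inab: "a \<le> Re (u * z) \<and> Re (u * z) \<le> b" if "dist q z \<le> e" for z
    using height_lipschitz[OF u, of q z] that \<open>Re (u * q) = c\<close> ab by (simp add: c_def e_def abs_le_iff field_simps)
  have inS: "z \<in> ?S" if "dist q z \<le> e" for z
    using inab[OF that] ab by (simp add: mem_strip)
  have "q \<in> X"
  proof (rule ccontr)
    assume "q \<notin> X"
    then obtain d where d: "d > 0" "ball q d \<subseteq> ?S - X"
      using \<open>open (?S - X)\<close> inS[of q] \<open>e > 0\<close> open_contains_ball by (metis DiffI dist_self less_imp_le)
    have "q \<in> W" if W: "W \<in> {W \<in> \<V>. dist q (p W) < d}" for W
    proof -
      have "W \<in> \<W>" "p W \<in> ball q d"
        using W \<V> by auto
      then have "ball q d \<subseteq> W"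
        using component_subset_component[OF comp(1) connected_ball d(2)] pW by blast
      then show ?thesis
        using d by auto
    qed
    then have "W = W'" if "W \<in> {W \<in> \<V>. dist q (p W) < d}" "W' \<in> {W \<in> \<V>. dist q (p W) < d}" for W W'
      using that disj \<V> by blast
    then have "finite {W \<in> \<V>. dist q (p W) < d}"
      by (rule finite_if_all_equal)
    then show False
      using near[OF d(1)] by blast
  qed
  obtain N d where N: "0 < d" "d \<le> e" "connected N" "N \<subseteq> X \<inter> ball q e" "X \<inter> ball q d \<subseteq> N"
    by (rule connected_neighbourhood[OF X(2) \<open>q \<in> X\<close> \<open>e > 0\<close>])
  define K where "K = closure N"
  have K: "compact K" "connected K" "K \<subseteq> X" "K \<subseteq> cball q e" "X \<inter> ball q d \<subseteq> K"
  proof -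
    show "K \<subseteq> X" "K \<subseteq> cball q e"
      unfolding K_def using N(4) \<open>closed X\<close> closed_cball by (intro closure_minimal; force)+
    then show "compact K"
      using X(1) by (metis K_def closed_closure compact_Int_closed inf.absorb2)
    show "connected K"
      unfolding K_def using N connected_imp_connected_closure by blast
    show "X \<inter> ball q d \<subseteq> K"
      using N closure_subset K_def by blast
  qed
  have "\<exists>n. n \<in> K \<and> closed_segment (p W) n \<subseteq> W \<union> {n} \<and> closed_segment (p W) n \<subseteq> ball q d"
    if W: "W \<in> \<V>" "dist q (p W) < d / 2" for W
  proof -
    obtain n where n: "n \<in> X" "\<And>y. y \<in> X \<Longrightarrow> dist (p W) n \<le> dist (p W) y"
      using distance_attains_inf[OF \<open>closed X\<close>, of "p W"] \<open>q \<in> X\<close> by blast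
    have pn: "dist (p W) n < d / 2"
      using n(2)[OF \<open>q \<in> X\<close>] W by (simp add: dist_commute)
    have seg: "closed_segment (p W) n \<subseteq> ball q d"
    proof
      fix z assume "z \<in> closed_segment (p W) n"
      then have "dist (p W) z < d / 2"
        using pn dist_in_closed_segment[of z "p W" n] by (simp add: dist_commute)
      then show "z \<in> ball q d"
        using W(2) dist_triangle_half_l[of q "p W" d z] dist_triangle[of q z "p W"] by simp
    qed
    then have "n \<in> K"
      using K(5) n by auto
    have "ball (p W) (dist (p W) n) \<subseteq> W"
    proof (cases "p W = n")
      case False
      show ?thesis
      proof (rule component_subset_component[OF comp(1)[OF \<V>[OF W(1)]]])
        show "ball (p W) (dist (p W) n) \<subseteq> ?S - X"
        proof
          fix z assume z: "z \<in> ball (p W) (dist (p W) n)"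
          then have "z \<notin> X"
            using n(2) by force
          moreover have "dist q z \<le> e"
            using z pn W(2) N(2) dist_triangle[of q z "p W"] by simp
          ultimately show "z \<in> ?S - X"
            using inS by blast
        qed
        show "ball (p W) (dist (p W) n) \<inter> W \<noteq> {}"
          using False pW \<V> W(1) by (metis IntI centre_in_ball empty_iff zero_less_dist_iff)
      qed auto
    qed auto
    moreover have "z \<in> ball (p W) (dist (p W) n) \<or> z = n" if "z \<in> closed_segment (p W) n" for z
    proof (cases "z = p W \<or> z = n")
      case True
      then show ?thesis
        by auto
    next
      case False
      then have "z \<in> open_segment (p W) n"
        using that by (auto simp: open_segment_def)
      then show ?thesis
        using dist_in_open_segment[of z "p W" n] by (simp add: dist_commute)
    qed
    ultimately have "closed_segment (p W) n \<subseteq> W \<union> {n}"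
      by blast
    then show ?thesis
      using \<open>n \<in> K\<close> seg by blast
  qed
  then obtain n where n: "\<And>W. \<lbrakk>W \<in> \<V>; dist q (p W) < d / 2\<rbrakk> \<Longrightarrow>
      n W \<in> K \<and> closed_segment (p W) (n W) \<subseteq> W \<union> {n W} \<and> closed_segment (p W) (n W) \<subseteq> ball q d"
    by metis
  have "infinite {W \<in> \<V>. dist q (p W) < d / 2}"
    using N(1) by (intro near) simp
  then obtain I where I: "I \<subseteq> {W \<in> \<V>. dist q (p W) < d / 2}" "card I = 3"
    using infinite_arbitrarily_large by blast
  show False
  proof (rule no_three_linked_crossings[where I = I and Q = Q and u = u and a = a and b = b])
    show "u \<noteq> 0"
      using u by auto
    show "card I = 3"
      by fact
    show "crosses u a b (Q W)" if "W \<in> I" for W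
      using Q \<V> I that by blast
    show "Q W \<inter> Q W' = {}" if "W \<in> I" "W' \<in> I" "W \<noteq> W'" for W W'
      using Q[OF \<V>, of W] Q[OF \<V>, of W'] disj[OF \<V> \<V>, of W W'] I that by blast
    fix W1 W2 W3 assume W: "W1 \<in> I" "W2 \<in> I" "W3 \<in> I" "W1 \<noteq> W2" "W2 \<noteq> W3" "W1 \<noteq> W3"
    define T where "T = closed_segment (p W1) (n W1) \<union> (K \<union> closed_segment (p W3) (n W3))"
    have IV: "W1 \<in> \<V>" "W2 \<in> \<V>" "W3 \<in> \<V>"
      using W I by auto
    have n1: "n W1 \<in> K" "closed_segment (p W1) (n W1) \<subseteq> W1 \<union> {n W1}" "closed_segment (p W1) (n W1) \<subseteq> ball q d"
      using n[OF IV(1)] W I by auto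
    have n3: "n W3 \<in> K" "closed_segment (p W3) (n W3) \<subseteq> W3 \<union> {n W3}" "closed_segment (p W3) (n W3) \<subseteq> ball q d"
      using n[OF IV(3)] W I by auto
    have "compact T"
      unfolding T_def using K by (intro compact_Un compact_segment)
    moreover have "connected T"
      unfolding T_def using K n1 n3 by (intro connected_Un connected_segment) auto
    moreover have "T \<subseteq> cball q e"
      using K(4) n1(3) n3(3) N(2) unfolding T_def by (force simp: subset_iff)
    moreover have "T \<inter> Q W1 \<noteq> {}" "T \<inter> Q W3 \<noteq> {}"
      using p[OF \<V>[OF IV(1)]] p[OF \<V>[OF IV(3)]] by (auto simp: T_def)
    moreover have "T \<inter> Q W2 = {}"
    proof -
      have "Q W2 \<subseteq> W2" "W2 \<inter> X = {}"
        using Q comp(4) \<V>[OF IV(2)] by blast+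
      moreover have "W1 \<inter> W2 = {}" "W3 \<inter> W2 = {}"
        using disj \<V> IV W by blast+
      ultimately show ?thesis
        using n1 n3 K(3) unfolding T_def by blast
    qed
    ultimately show "\<exists>T. compact T \<and> connected T \<and> (\<forall>z\<in>T. a \<le> Re (u * z) \<and> Re (u * z) \<le> b) \<and>
          T \<inter> Q W1 \<noteq> {} \<and> T \<inter> Q W3 \<noteq> {} \<and> T \<inter> Q W2 = {}"
      using inab by (intro exI[of _ T]) (auto simp: subset_iff)
  qed
qed

text \<open>
  Lets finiteness results about regions of the strip off \<open>X\<close> be applied to pieces of one component \<open>U\<close>.
\<close>

lemma component_of_component_Int:
  assumes U: "U \<in> components (- X)" and W: "W \<in> components (U \<inter> S)"
  shows "W \<in> components (S - X)"
proof -
  have UX: "U \<subseteq> - X"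
    using U in_components_subset by blast
  have WUS: "W \<subseteq> U \<inter> S" "connected W" "W \<noteq> {}"
    using W in_components_subset in_components_connected in_components_nonempty by blast+
  show ?thesis
    unfolding in_components_maximal
  proof (intro conjI allI impI)
    show "W \<noteq> {}" "W \<subseteq> S - X" "connected W"
      using WUS UX by auto
    fix D assume D: "D \<noteq> {} \<and> W \<subseteq> D \<and> D \<subseteq> S - X \<and> connected D"
    then have D': "connected D" "D \<subseteq> - X" "D \<inter> U \<noteq> {}" "D \<inter> W \<noteq> {}"
      using WUS by blast+
    have "D \<subseteq> U"
      by (rule component_subset_component[OF U D'(1,2,3)])
    then have "D \<subseteq> U \<inter> S"
      using D by blast
    then have "D \<subseteq> W"
      by (rule component_subset_component[OF W D'(1) _ D'(4)])
    then show "D = W"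
      using D by blast
  qed
qed

text \<open>
  Unless \<open>U\<close> lies inside the strip, a piece of \<open>U\<close> that comes near the middle must leave the strip on
  one side, for otherwise it would be open and closed in \<open>U\<close>.  So it crosses one of two thinner strips.
\<close>

lemma finite_regions_near_line:
  assumes X: "compact X" "locally connected X" and U: "U \<in> components (- X)" and u: "norm u = 1"
    and ab: "a < a'" "a' < b'" "b' < b"
  shows "finite {W \<in> components (U \<inter> strip u a b). \<exists>z\<in>W. a' \<le> Re (u * z) \<and> Re (u * z) \<le> b'}"
    (is "finite ?\<F>")
proof -
  define a1 where "a1 = (a + a') / 2"
  define b1 where "b1 = (b + b') / 2"
  have a1: "a < a1" "a1 < a'" and b1: "b' < b1" "b1 < b"
    using ab by (auto simp: a1_def b1_def)
  define \<C> where "\<C> c d = {W \<in> components (strip u a b - X).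
                  (\<exists>z\<in>W. Re (u * z) \<le> c) \<and> (\<exists>z\<in>W. d \<le> Re (u * z))}" for c d
  have fin: "finite (\<C> a1 a')" "finite (\<C> b' b1)"
    unfolding \<C>_def using a1 b1 ab by (intro finite_crossing_regions[OF X u]; linarith)+
  have "open U" "connected U"
    using U X open_components[of "- X"] in_components_connected by (auto simp: compact_imp_closed open_Compl)
  have "open (U \<inter> strip u a b)"
    using \<open>open U\<close> open_strip by blast
  have "?\<F> \<subseteq> insert U (\<C> a1 a' \<union> \<C> b' b1)"
  proof
    fix W assume W: "W \<in> ?\<F>"
    then have comp: "W \<in> components (U \<inter> strip u a b)"
      by blast
    obtain z where z: "z \<in> W" "a' \<le> Re (u * z)" "Re (u * z) \<le> b'"
      using W by blast
    have WX: "W \<in> components (strip u a b - X)"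
      using component_of_component_Int[OF U comp] .
    show "W \<in> insert U (\<C> a1 a' \<union> \<C> b' b1)"
    proof (cases "\<exists>w\<in>W. Re (u * w) \<le> a1 \<or> b1 \<le> Re (u * w)")
      case True
      then show ?thesis
        using WX z by (auto simp: \<C>_def)
    next
      case False
      have WU: "W \<subseteq> U"
        using comp in_components_subset by blast
      have "closure W \<inter> U \<subseteq> W"
      proof
        fix w assume w: "w \<in> closure W \<inter> U"
        have "closed {w. a1 \<le> Re (u * w) \<and> Re (u * w) \<le> b1}"
          by (intro closed_Collect_conj closed_Collect_le continuous_intros)
        moreover have "W \<subseteq> {w. a1 \<le> Re (u * w) \<and> Re (u * w) \<le> b1}"
          using False by force
        ultimately have "closure W \<subseteq> {w. a1 \<le> Re (u * w) \<and> Re (u * w) \<le> b1}"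
          by (rule closure_minimal[rotated])
        then have "w \<in> U \<inter> strip u a b"
          using w a1 b1 by (auto simp: mem_strip)
        moreover have "closedin (top_of_set (U \<inter> strip u a b)) W"
          by (rule closedin_component[OF comp])
        ultimately show "w \<in> W"
          using w unfolding closedin_closed by (metis IntE IntI closure_minimal inf_le2 subset_iff)
      qed
      moreover have "open W"
        using open_components \<open>open (U \<inter> strip u a b)\<close> comp by blast
      moreover have "W \<noteq> {}"
        using z by blast
      ultimately have "U \<inter> (- closure W) = {}"
        using connectedD[OF \<open>connected U\<close>, of W "- closure W"] WU closure_subset[of W] by auto
      then have "W = U"
        using \<open>closure W \<inter> U \<subseteq> W\<close> WU by blast
      then show ?thesis
        by blast
    qed
  qed
  then show ?thesis
    using fin by (meson finite_Un finite_insert finite_subset)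
qed

lemma finite_cover_of_frontier_on_line:
  assumes X: "compact X" "locally connected X" and U: "U \<in> components (- X)" and u: "norm u = 1"
    and "a < c" "c < b"
  obtains \<W> where "finite \<W>" "\<And>W. W \<in> \<W> \<Longrightarrow> W \<in> components (strip u a b - X) \<and> W \<subseteq> U"
    "{k \<in> frontier U. Re (u * k) = c} \<subseteq> (\<Union>W\<in>\<W>. closure W)"
proof -
  define a' where "a' = (a + c) / 2"
  define b' where "b' = (c + b) / 2"
  have ab: "a < a'" "a' < c" "c < b'" "b' < b"
    using assms by (auto simp: a'_def b'_def)
  define \<W> where "\<W> = {W \<in> components (U \<inter> strip u a b). \<exists>z\<in>W. a' \<le> Re (u * z) \<and> Re (u * z) \<le> b'}"
  have "finite \<W>"
    unfolding \<W>_def using ab by (intro finite_regions_near_line[OF X U u]) auto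
  moreover have "W \<in> components (strip u a b - X) \<and> W \<subseteq> U" if "W \<in> \<W>" for W
  proof -
    have "W \<in> components (U \<inter> strip u a b)"
      using that by (simp add: \<W>_def)
    then show ?thesis
      using component_of_component_Int[OF U] in_components_subset by blast
  qed
  moreover have "{k \<in> frontier U. Re (u * k) = c} \<subseteq> (\<Union>W\<in>\<W>. closure W)"
  proof
    fix k assume k: "k \<in> {k \<in> frontier U. Re (u * k) = c}"
    then have "k \<in> strip u a' b' \<inter> closure U"
      using ab by (auto simp: mem_strip frontier_def)
    then have "k \<in> closure (strip u a' b' \<inter> U)"
      using open_Int_closure_subset[OF open_strip] by blast
    also have "strip u a' b' \<inter> U \<subseteq> \<Union>\<W>"
    proof
      fix z assume z: "z \<in> strip u a' b' \<inter> U"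
      then have "z \<in> U \<inter> strip u a b"
        using ab by (auto simp: mem_strip)
      then obtain W where W: "W \<in> components (U \<inter> strip u a b)" "z \<in> W"
        using Union_components[of "U \<inter> strip u a b"] by blast
      moreover have "a' \<le> Re (u * z) \<and> Re (u * z) \<le> b'"
        using z by (simp add: mem_strip)
      ultimately show "z \<in> \<Union>\<W>"
        unfolding \<W>_def by blast
    qed
    then have "closure (strip u a' b' \<inter> U) \<subseteq> (\<Union>W\<in>\<W>. closure W)"
      using \<open>finite \<W>\<close> closure_subset by (intro closure_minimal closed_UN) blast+
    finally show "k \<in> (\<Union>W\<in>\<W>. closure W)" .
  qed
  ultimately show thesis
    by (rule that)
qed

section \<open>Boundaries of complementary components\<close>

text \<open>
  This is a classical theorem of Torhorst.  Infinitely many disjoint crossing continua in \<open>frontier U\<close>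
  would meet the middle line in points adherent to finitely many pieces of \<open>U\<close>.  One connected piece,
  which is disjoint from \<open>X\<close>, would then touch three of the continua and link them.
\<close>

lemma Torhorst:
  fixes X :: "complex set"
  assumes X: "compact X" "connected X" "locally connected X" and U: "U \<in> components (- X)"
  shows "locally connected (frontier U)"
proof (rule ccontr)
  assume nlc: "\<not> locally connected (frontier U)"
  have "frontier U \<subseteq> frontier (- X)"
    by (rule frontier_of_components_subset[OF U])
  then have UX: "frontier U \<subseteq> X"
    using frontier_subset_closed[OF compact_imp_closed[OF X(1)]] by simp
  have K: "compact (frontier U)"
    using closed_Int_compact[OF frontier_closed X(1), of U] UX by (simp add: inf.absorb1)
  have conn: "connected (frontier U)"
    by (rule connected_frontier_component_complement[OF X(2) U])
  obtain u a b \<Q> where u: "norm u = 1" and "a < b" and inf: "infinite \<Q>"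
    and disj: "pairwise disjnt \<Q>" and \<Q>: "\<And>Q. Q \<in> \<Q> \<Longrightarrow> Q \<subseteq> frontier U \<and> crosses u a b Q"
    using infinitely_many_crossings[OF K conn nlc] by metis
  define c where "c = (a + b) / 2"
  have c: "a < c" "c < b"
    using \<open>a < b\<close> by (auto simp: c_def)
  obtain \<W> where \<W>: "finite \<W>" "\<And>W. W \<in> \<W> \<Longrightarrow> W \<in> components (strip u a b - X) \<and> W \<subseteq> U"
    "{k \<in> frontier U. Re (u * k) = c} \<subseteq> (\<Union>W\<in>\<W>. closure W)"
    using finite_cover_of_frontier_on_line[OF X(1,3) U u c] by metis
  have "\<exists>q. q \<in> Q \<and> Re (u * q) = c" if "Q \<in> \<Q>" for Q
    using crosses_intermediate[of u a b Q c] \<Q>[OF that] c by (metis less_imp_le)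
  then obtain q where q: "\<And>Q. Q \<in> \<Q> \<Longrightarrow> q Q \<in> Q \<and> Re (u * q Q) = c"
    by metis
  have "\<Q> \<subseteq> (\<Union>W\<in>\<W>. {Q \<in> \<Q>. q Q \<in> closure W})"
  proof
    fix Q assume Q: "Q \<in> \<Q>"
    then have "q Q \<in> {k \<in> frontier U. Re (u * k) = c}"
      using q[OF Q] \<Q>[OF Q] by blast
    then obtain W where "W \<in> \<W>" "q Q \<in> closure W"
      using \<W>(3) by blast
    then show "Q \<in> (\<Union>W\<in>\<W>. {Q \<in> \<Q>. q Q \<in> closure W})"
      using Q by blast
  qed
  then obtain W where W: "W \<in> \<W>" "infinite {Q \<in> \<Q>. q Q \<in> closure W}"
    using inf \<W>(1) by (meson finite_UN_I finite_subset)
  obtain I where I: "I \<subseteq> {Q \<in> \<Q>. q Q \<in> closure W}" "card I = 3"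
    using W(2) infinite_arbitrarily_large by blast
  have comp: "W \<in> components (strip u a b - X)"
    using \<W> W by blast
  have "open (strip u a b - X)"
    using open_strip X by (simp add: compact_imp_closed open_Diff)
  then have Wprops: "open W" "connected W" "W \<subseteq> strip u a b - X"
    using open_components comp in_components_connected in_components_subset by blast+
  have IQ: "Q \<in> \<Q>" "q Q \<in> closure W" "q Q \<in> Q" "Q \<subseteq> X" "crosses u a b Q" "q Q \<in> strip u a b" if "Q \<in> I" for Q
  proof -
    show *: "Q \<in> \<Q>" and "q Q \<in> closure W"
      using that I by auto
    show "q Q \<in> Q" "Q \<subseteq> X" "crosses u a b Q" "q Q \<in> strip u a b"
      using q[OF *] \<Q>[OF *] UX c by (auto simp: mem_strip)
  qed
  have Idisj: "Q \<inter> Q' = {}" if "Q \<in> I" "Q' \<in> I" "Q \<noteq> Q'" for Q Q'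
    using disj that IQ(1) unfolding pairwise_def disjnt_def by blast
  show False
  proof (rule no_three_linked_crossings[where I = I and Q = "\<lambda>Q. Q" and u = u and a = a and b = b])
    show "u \<noteq> 0"
      using u by auto
    show "card I = 3"
      by fact
    show "crosses u a b Q" if "Q \<in> I" for Q
      using IQ that by blast
    show "Q \<inter> Q' = {}" if "Q \<in> I" "Q' \<in> I" "Q \<noteq> Q'" for Q Q'
      using Idisj that by blast
    fix Q1 Q2 Q3 assume Qs: "Q1 \<in> I" "Q2 \<in> I" "Q3 \<in> I" "Q1 \<noteq> Q2" "Q2 \<noteq> Q3" "Q1 \<noteq> Q3"
    have approach: "\<exists>w\<in>W. closed_segment w (q Q) \<subseteq> strip u a b - Q2" if Q: "Q \<in> I" "Q \<noteq> Q2" for Q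
    proof -
      have "closed Q2"
        using IQ(5)[OF Qs(2)] by (simp add: crosses_def compact_imp_closed)
      then have "open (strip u a b - Q2)"
        using open_strip by blast
      moreover have "q Q \<in> strip u a b - Q2"
        using IQ(3,6)[OF Q(1)] Idisj[OF Q(1) Qs(2) Q(2)] by blast
      ultimately obtain r where r: "r > 0" "ball (q Q) r \<subseteq> strip u a b - Q2"
        using open_contains_ball by blast
      obtain w where w: "w \<in> W" "dist w (q Q) < r"
        using IQ(2)[OF Q(1)] r(1) closure_approachable by blast
      have "closed_segment w (q Q) \<subseteq> ball (q Q) r"
        using w r by (intro closed_segment_subset convex_ball) (auto simp: dist_commute)
      then show ?thesis
        using w r by blast
    qed
    obtain w1 where w1: "w1 \<in> W" "closed_segment w1 (q Q1) \<subseteq> strip u a b - Q2"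
      using approach[OF Qs(1,4)] by blast
    obtain w3 where w3: "w3 \<in> W" "closed_segment w3 (q Q3) \<subseteq> strip u a b - Q2"
      using approach[OF Qs(3)] Qs by blast
    obtain g where g: "path g" "path_image g \<subseteq> W" "pathstart g = w1" "pathfinish g = w3"
      using connected_open_path_connected[OF Wprops(1,2)] w1 w3 unfolding path_connected_def by blast
    define T where "T = closed_segment w1 (q Q1) \<union> (path_image g \<union> closed_segment w3 (q Q3))"
    have "compact T"
      unfolding T_def using g by (intro compact_Un compact_segment compact_path_image)
    moreover have "connected T"
      unfolding T_def using g pathstart_in_path_image[of g] pathfinish_in_path_image[of g]
      by (intro connected_Un connected_segment connected_path_image) auto
    moreover have "T \<subseteq> strip u a b - Q2"
      using w1 w3 g Wprops(3) IQ(4)[OF Qs(2)] by (auto simp: T_def)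
    moreover have "T \<inter> Q1 \<noteq> {}" "T \<inter> Q3 \<noteq> {}"
      using IQ(3) Qs by (auto simp: T_def)
    ultimately show "\<exists>T. compact T \<and> connected T \<and> (\<forall>z\<in>T. a \<le> Re (u * z) \<and> Re (u * z) \<le> b) \<and>
          T \<inter> Q1 \<noteq> {} \<and> T \<inter> Q3 \<noteq> {} \<and> T \<inter> Q2 = {}"
      by (intro exI[of _ T]) (auto simp: mem_strip subset_iff less_imp_le)
  qed
qed

section \<open>Finite separators\<close>

text \<open>
  Being joined by a continuum inside \<open>G\<close> is an equivalence relation with open classes, because the
  closure of a small connected neighbourhood is a continuum.
\<close>

lemma joined_by_continuum:
  fixes K :: "'a::heine_borel set"
  assumes K: "compact K" "locally connected K" and G: "openin (top_of_set K) G"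
    and xy: "connected_component G x y"
  obtains H where "compact H" "connected H" "H \<subseteq> G" "x \<in> H" "y \<in> H"
proof -
  define R where "R p q \<longleftrightarrow> (\<exists>H. compact H \<and> connected H \<and> H \<subseteq> G \<and> p \<in> H \<and> q \<in> H)" for p q
  define D where "D = connected_component_set G x"
  have xyD: "x \<in> D" "y \<in> D"
    using xy connected_component_in[OF xy] by (auto simp: D_def connected_component_refl)
  have "D \<subseteq> G"
    by (simp add: D_def connected_component_subset)
  have "R x y"
  proof (rule connected_equivalence_relation[of D])
    show "connected D"
      by (simp add: D_def)
    show "x \<in> D" "y \<in> D"
      by (fact xyD)+
    show "R q p" if "R p q" for p q
      using that unfolding R_def by blast
    show "R p s" if pq: "R p q" and qs: "R q s" for p q s
    proof -
      obtain H H' where "compact H" "connected H" "H \<subseteq> G" "p \<in> H" "q \<in> H"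
        "compact H'" "connected H'" "H' \<subseteq> G" "q \<in> H'" "s \<in> H'"
        using pq qs unfolding R_def by blast
      then show ?thesis
        unfolding R_def by (intro exI[of _ "H \<union> H'"]) (auto intro!: compact_Un connected_Un)
    qed
    fix p assume "p \<in> D"
    then have "p \<in> G"
      using \<open>D \<subseteq> G\<close> by blast
    then have "p \<in> K"
      using G openin_imp_subset by blast
    obtain e where e: "e > 0" "K \<inter> cball p e \<subseteq> G"
      using G \<open>p \<in> G\<close> unfolding openin_contains_cball by (metis Int_commute)
    obtain N d where N: "0 < d" "d \<le> e" "connected N" "N \<subseteq> K \<inter> ball p e" "K \<inter> ball p d \<subseteq> N"
      by (rule connected_neighbourhood[OF K(2) \<open>p \<in> K\<close> e(1)])
    have clN: "closure N \<subseteq> K \<inter> cball p e"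
      using N(4) K(1) by (intro closure_minimal closed_Int compact_imp_closed) auto
    then have "compact (closure N)"
      using K(1) by (metis closed_closure compact_Int_closed inf.absorb2 le_inf_iff)
    then have "R p s" if "s \<in> N" for s
      using that clN e N(3,5) N(1) \<open>p \<in> K\<close> closure_subset[of N]
      unfolding R_def by (intro exI[of _ "closure N"]) (auto simp: subset_iff intro: connected_imp_connected_closure)
    then show "\<exists>T. openin (top_of_set D) T \<and> p \<in> T \<and> (\<forall>s\<in>T. R p s)"
      using N(1,5) \<open>p \<in> D\<close> \<open>D \<subseteq> G\<close> openin_imp_subset[OF G]
      by (intro exI[of _ "D \<inter> ball p d"]) auto
  qed
  then show thesis
    using that unfolding R_def by blast
qed

text \<open>
  For \<open>u \<noteq> 0\<close> this is the point \<open>z\<close> with \<open>Re (u * z) = c\<close> and \<open>Im (u * z) = t\<close>.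
\<close>

definition line_point :: "complex \<Rightarrow> real \<Rightarrow> real \<Rightarrow> complex" where
  "line_point u c t = Complex c t / u"

text \<open>
  Call a point off \<open>K\<close> reachable if, for some finite \<open>C\<close> on the line, it is connected with the lower
  end of the line inside the strip in the complement of every closed subset of \<open>K - C\<close>.  Reachability
  passes through connected sets off \<open>K\<close>, and also from one such set to another when their closures
  share a point \<open>k\<close> of \<open>K\<close> on the line: add \<open>k\<close> to \<open>C\<close>, and cross in a small disc around \<open>k\<close>.
  Thus \<open>K\<close> on the line splits into the part \<open>E\<close> adherent to reachable sets and the rest \<open>F\<close>, both
  closed by the finite cover, and connectedness of the line makes its upper end reachable.

  Reachability quantifies over closed sets instead of asking for a path through the points of \<open>C\<close>;
  this avoids the question whether those points are accessible from the regions.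
\<close>

lemma chain_along_line:
  assumes K: "compact K" and u: "norm u = 1" and c: "a < c" "c < b"
    and W: "finite \<W>" "\<And>W. W \<in> \<W> \<Longrightarrow> connected W \<and> W \<subseteq> strip u a b - K"
    and cover: "{k \<in> K. Re (u * k) = c} \<subseteq> (\<Union>W\<in>\<W>. closure W)"
    and M: "\<And>k. k \<in> K \<Longrightarrow> norm k < M"
  obtains C where "finite C" "C \<subseteq> {k \<in> K. Re (u * k) = c}"
    "\<forall>H. closed H \<longrightarrow> H \<subseteq> K - C \<longrightarrow>
      connected_component (strip u a b - H) (line_point u c (- M)) (line_point u c M)"
proof -
  define S where "S = strip u a b"
  define \<gamma> where "\<gamma> = line_point u c"
  have "u \<noteq> 0"
    using u by auto
  have \<gamma>: "u * \<gamma> t = Complex c t" for t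
    using \<open>u \<noteq> 0\<close> by (simp add: \<gamma>_def line_point_def)
  have cont: "continuous_on T \<gamma>" for T
  proof -
    have "\<gamma> = (\<lambda>t. (of_real c + \<i> * of_real t) / u)"
      by (auto simp: \<gamma>_def line_point_def Complex_eq)
    then show ?thesis
      using \<open>u \<noteq> 0\<close> by (auto intro!: continuous_intros)
  qed
  have \<gamma>S: "\<gamma> t \<in> S" for t
    using c by (simp add: S_def mem_strip \<gamma>)
  have "closed K"
    using K compact_imp_closed by blast
  have out: "\<gamma> t \<notin> K" if "M \<le> \<bar>t\<bar>" for t
  proof
    assume "\<gamma> t \<in> K"
    then have "norm (\<gamma> t) < M"
      by (rule M)
    moreover have "norm (\<gamma> t) = norm (u * \<gamma> t)"
      using u by (simp add: norm_mult)
    moreover have "\<bar>t\<bar> \<le> norm (u * \<gamma> t)"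
      using abs_Im_le_cmod[of "u * \<gamma> t"] by (simp add: \<gamma>)
    ultimately show False
      using that by linarith
  qed
  have out_ends: "\<gamma> (- M) \<notin> K" "\<gamma> M \<notin> K"
    by (rule out, linarith)+
  define Kc where "Kc = {k \<in> K. Re (u * k) = c}"
  have \<gamma>Kc: "\<gamma> t \<in> Kc \<longleftrightarrow> \<gamma> t \<in> K" for t
    by (simp add: Kc_def \<gamma>)
  define z0 where "z0 = \<gamma> (- M)"
  define reach where "reach z \<longleftrightarrow> (\<exists>C. finite C \<and> C \<subseteq> Kc \<and>
      (\<forall>H. closed H \<longrightarrow> H \<subseteq> K - C \<longrightarrow> connected_component (S - H) z0 z))" for z
  have reach_connected: "reach w" if T: "connected T" "T \<subseteq> S - K" "z \<in> T" "w \<in> T" and z: "reach z" for T z w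
  proof -
    obtain C where C: "finite C" "C \<subseteq> Kc"
      "\<And>H. \<lbrakk>closed H; H \<subseteq> K - C\<rbrakk> \<Longrightarrow> connected_component (S - H) z0 z"
      using z unfolding reach_def by blast
    have "connected_component (S - H) z0 w" if H: "closed H" "H \<subseteq> K - C" for H
    proof -
      have "T \<subseteq> S - H"
        using T(2) H(2) by blast
      then have "connected_component (S - H) z w"
        using T by (meson connected_componentI)
      then show ?thesis
        using C(3)[OF H] connected_component_trans by metis
    qed
    then show ?thesis
      unfolding reach_def using C(1,2) by blast
  qed
  have reach_through: "reach w"
    if T: "connected T" "T \<subseteq> S - K" "z \<in> T" and T': "connected T'" "T' \<subseteq> S - K" "w \<in> T'"
      and k: "k \<in> Kc" "k \<in> closure T" "k \<in> closure T'" and z: "reach z" for T T' z w k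
  proof -
    obtain C where C: "finite C" "C \<subseteq> Kc"
      "\<And>H. \<lbrakk>closed H; H \<subseteq> K - C\<rbrakk> \<Longrightarrow> connected_component (S - H) z0 z"
      using z unfolding reach_def by blast
    have "connected_component (S - H) z0 w" if H: "closed H" "H \<subseteq> K - insert k C" for H
    proof -
      have "open (S - H)"
        using H open_strip by (auto simp: S_def)
      moreover have "k \<in> S - H"
        using k(1) H c by (auto simp: S_def mem_strip Kc_def)
      ultimately obtain r where r: "r > 0" "ball k r \<subseteq> S - H"
        using open_contains_ball by blast
      have "T \<inter> ball k r \<noteq> {}" "ball k r \<inter> T' \<noteq> {}"
        using k(2,3) r(1) unfolding closure_approachable by (force simp: dist_commute)+
      then have "connected (T \<union> (ball k r \<union> T'))"
        using T T' by (intro connected_Un) auto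
      moreover have "T \<union> (ball k r \<union> T') \<subseteq> S - H"
        using T(2) T'(2) r(2) H(2) by blast
      ultimately have "connected_component (S - H) z w"
        using T(3) T'(3) by (meson UnCI connected_componentI)
      moreover have "connected_component (S - H) z0 z"
        using C(3)[OF H(1)] H(2) by blast
      ultimately show ?thesis
        using connected_component_trans by metis
    qed
    then show ?thesis
      unfolding reach_def using C(1,2) k(1) by (intro exI[of _ "insert k C"]) auto
  qed
  define E where "E = {k \<in> Kc. \<exists>T z. connected T \<and> T \<subseteq> S - K \<and> z \<in> T \<and> reach z \<and> k \<in> closure T}"
  define F where "F = Kc - E"
  have E_iff: "k \<in> E \<longleftrightarrow> reach z" if k: "k \<in> Kc" "k \<in> closure T" and T: "connected T" "T \<subseteq> S - K" "z \<in> T" for k T z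
  proof
    assume "k \<in> E"
    then obtain T' z' where "connected T'" "T' \<subseteq> S - K" "z' \<in> T'" "reach z'" "k \<in> closure T'"
      by (auto simp: E_def)
    then show "reach z"
      using reach_through[of T' z' T z k] k T by blast
  next
    assume "reach z"
    then show "k \<in> E"
      using k T by (auto simp: E_def)
  qed
  have "closed Kc"
  proof -
    have "Kc = K \<inter> {k. Re (u * k) = c}"
      by (auto simp: Kc_def)
    then show ?thesis
      using \<open>closed K\<close> by (auto intro!: closed_Int closed_Collect_eq continuous_intros)
  qed
  have Kc_cover: "\<exists>W\<in>\<W>. k \<in> closure W \<and> (\<exists>z. z \<in> W)" if "k \<in> Kc" for k
  proof -
    obtain W where "W \<in> \<W>" "k \<in> closure W"
      using \<open>k \<in> Kc\<close> cover unfolding Kc_def by blast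
    moreover have "W \<noteq> {}"
      using \<open>k \<in> closure W\<close> by auto
    ultimately show ?thesis
      by blast
  qed
  have EF: "E = Kc \<inter> (\<Union>W\<in>{W\<in>\<W>. \<exists>z\<in>W. reach z}. closure W)"
      "F = Kc \<inter> (\<Union>W\<in>{W\<in>\<W>. \<exists>z\<in>W. \<not> reach z}. closure W)"
  proof -
    have *: "k \<in> E \<longleftrightarrow> reach z" if "k \<in> Kc" "W \<in> \<W>" "k \<in> closure W" "z \<in> W" for k W z
      using E_iff[of k W z] W(2)[of W] that by (simp add: S_def)
    have **: "E \<subseteq> Kc"
      by (auto simp: E_def)
    show "E = Kc \<inter> (\<Union>W\<in>{W\<in>\<W>. \<exists>z\<in>W. reach z}. closure W)"
    proof (intro equalityI subsetI)
      fix k assume "k \<in> E"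
      then show "k \<in> Kc \<inter> (\<Union>W\<in>{W\<in>\<W>. \<exists>z\<in>W. reach z}. closure W)"
        using Kc_cover[of k] * ** by blast
    qed (use * in blast)
    show "F = Kc \<inter> (\<Union>W\<in>{W\<in>\<W>. \<exists>z\<in>W. \<not> reach z}. closure W)"
    proof (intro equalityI subsetI)
      fix k assume "k \<in> F"
      then show "k \<in> Kc \<inter> (\<Union>W\<in>{W\<in>\<W>. \<exists>z\<in>W. \<not> reach z}. closure W)"
        using Kc_cover[of k] * unfolding F_def by blast
    qed (use * in \<open>auto simp: F_def\<close>)
  qed
  have "closed E" "closed F"
    using \<open>closed Kc\<close> W(1) unfolding EF by (auto intro!: closed_Int closed_UN)
  define P where "P t \<longleftrightarrow> \<gamma> t \<in> E \<or> \<gamma> t \<notin> K \<and> reach (\<gamma> t)" for t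
  have openvimage: "open {t. \<gamma> t \<in> V}" if "open V" for V
    using open_vimage[OF that cont] by (simp add: vimage_def)
  have "P M"
  proof (rule connected_induction_simple[of UNIV "- M"])
    show "connected (UNIV :: real set)"
      by simp
    have "reach z0"
      unfolding reach_def
    proof (intro exI[of _ "{}"] conjI allI impI)
      fix H assume "closed H" "H \<subseteq> K - {}"
      then have "z0 \<in> S - H"
        using \<gamma>S out_ends by (auto simp: z0_def)
      then show "connected_component (S - H) z0 z0"
        by (rule connected_component_refl)
    qed auto
    then show "P (- M)"
      using out_ends by (auto simp: P_def z0_def)
    fix t :: real
    show "\<exists>T. openin (top_of_set UNIV) T \<and> t \<in> T \<and> (\<forall>x\<in>T. \<forall>y\<in>T. P x \<longrightarrow> P y)"
    proof (cases "\<gamma> t \<in> K")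
      case False
      have "open {t. \<gamma> t \<in> - K}"
        using \<open>closed K\<close> by (intro openvimage) auto
      then obtain e where e: "e > 0" "ball t e \<subseteq> {t. \<gamma> t \<in> - K}"
        using False open_contains_ball by blast
      have "P s \<longrightarrow> P r" if "s \<in> ball t e" "r \<in> ball t e" for s r
      proof -
        have "\<gamma> s \<notin> K" "\<gamma> r \<notin> K"
          using e(2) that by auto
        moreover have "connected (\<gamma> ` ball t e)"
          by (intro connected_continuous_image cont connected_ball)
        moreover have "\<gamma> ` ball t e \<subseteq> S - K"
          using e(2) \<gamma>S by auto
        moreover have "\<gamma> s \<notin> E"
          using \<open>\<gamma> s \<notin> K\<close> by (auto simp: E_def Kc_def)
        ultimately show ?thesis
          using reach_connected[of "\<gamma> ` ball t e" "\<gamma> s" "\<gamma> r"] that by (auto simp: P_def)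
      qed
      moreover have "openin (top_of_set UNIV) (ball t e)" "t \<in> ball t e"
        using e(1) by simp_all
      ultimately show ?thesis
        by blast
    next
      case True
      define V where "V = (if \<gamma> t \<in> E then - F else - E)"
      have "open V"
        using \<open>closed E\<close> \<open>closed F\<close> by (simp add: V_def open_Compl)
      have "\<gamma> t \<in> V"
        by (auto simp: V_def F_def)
      then obtain e where e: "e > 0" "ball t e \<subseteq> {t. \<gamma> t \<in> V}"
        using openvimage[OF \<open>open V\<close>] open_contains_ball by blast
      have same: "\<gamma> s \<in> E \<longleftrightarrow> \<gamma> t \<in> E" if "\<gamma> s \<in> K" "dist t s < e" for s
      proof -
        have "\<gamma> s \<in> V"
          using e(2) that(2) by auto
        then show ?thesis
          using that(1) \<gamma>Kc[of s] by (auto simp: V_def F_def split: if_splits)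
      qed
      have "P s \<longleftrightarrow> \<gamma> t \<in> E" if s: "s \<in> ball t (e / 2)" for s
      proof (cases "\<gamma> s \<in> K")
        case True
        then show ?thesis
          using same[of s] s e(1) by (auto simp: P_def)
      next
        case False
        define J where "J = {r. \<gamma> r \<in> K}"
        have "closed J"
          using openvimage[of "- K"] \<open>closed K\<close> by (simp add: closed_def Collect_neg_eq J_def)
        moreover have "t \<in> J"
          using \<open>\<gamma> t \<in> K\<close> by (simp add: J_def)
        ultimately obtain r where "r \<in> J" "\<And>r'. r' \<in> J \<Longrightarrow> dist s r \<le> dist s r'"
          using distance_attains_inf[of J s] by blast
        then have r: "\<gamma> r \<in> K" "\<And>r'. \<gamma> r' \<in> K \<Longrightarrow> dist s r \<le> dist s r'"
          by (simp_all add: J_def)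
        have "dist s r \<le> dist s t"
          using r(2) \<open>\<gamma> t \<in> K\<close> by blast
        then have "dist t r < e"
          using s dist_triangle[of t r s] by (simp add: dist_commute)
        have "s \<noteq> r"
          using False r(1) by blast
        define T where "T = \<gamma> ` ball s (dist s r)"
        have "connected T"
          unfolding T_def by (intro connected_continuous_image cont connected_ball)
        moreover have "T \<subseteq> S - K"
        proof -
          have "\<gamma> r' \<notin> K" if "dist s r' < dist s r" for r'
            using r(2) that by force
          then show ?thesis
            using \<gamma>S by (auto simp: T_def)
        qed
        moreover have "\<gamma> s \<in> T"
          using \<open>s \<noteq> r\<close> by (auto simp: T_def)
        moreover have "\<gamma> r \<in> closure T"
        proof -
          have "r \<in> closure (ball s (dist s r))"
            using \<open>s \<noteq> r\<close> by simp
          then show ?thesis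
            unfolding T_def using image_closure_subset[OF cont closed_closure closure_subset] by blast
        qed
        ultimately have "\<gamma> r \<in> E \<longleftrightarrow> reach (\<gamma> s)"
          using E_iff[of "\<gamma> r" T "\<gamma> s"] r(1) \<gamma>Kc by blast
        moreover have "\<gamma> s \<notin> E"
          using False by (auto simp: E_def Kc_def)
        ultimately show ?thesis
          using False same[OF r(1) \<open>dist t r < e\<close>] by (auto simp: P_def)
      qed
      moreover have "openin (top_of_set UNIV) (ball t (e / 2))" "t \<in> ball t (e / 2)"
        using e(1) by simp_all
      ultimately show ?thesis
        by blast
    qed
  qed auto
  then have "reach (\<gamma> M)"
    using out_ends by (auto simp: P_def E_def Kc_def)
  then obtain C where "finite C" "C \<subseteq> Kc"
      "\<forall>H. closed H \<longrightarrow> H \<subseteq> K - C \<longrightarrow> connected_component (S - H) z0 (\<gamma> M)"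
    unfolding reach_def by blast
  then show thesis
    using that[of C] unfolding Kc_def S_def z0_def \<gamma>_def by blast
qed

text \<open>
  The path is prolonged along the middle line, where \<open>H\<close> is too small to reach, and the continuum
  sideways beyond \<open>x\<close> and \<open>y\<close>, until both cross a large box.
\<close>

lemma path_along_strip_meets_continuum:
  assumes u: "norm u = 1" and ab: "a < c" "c < b"
    and H: "compact H" "connected H" "x \<in> H" "Re (u * x) \<le> a" "y \<in> H" "b \<le> Re (u * y)"
    and M: "\<And>z. z \<in> H \<Longrightarrow> norm z < M"
    and g: "path g" "path_image g \<subseteq> strip u a b" "pathstart g = line_point u c (- M)" "pathfinish g = line_point u c M"
  shows "path_image g \<inter> H \<noteq> {}"
proof
  assume disj: "path_image g \<inter> H = {}"
  have "u \<noteq> 0"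
    using u by auto
  have \<gamma>: "u * line_point u c t = Complex c t" for t
    using \<open>u \<noteq> 0\<close> by (simp add: line_point_def)
  have "bounded (path_image g \<union> H)"
    using g(1) H(1) by (simp add: bounded_path_image compact_imp_bounded)
  then obtain R where R: "\<And>z. z \<in> path_image g \<union> H \<Longrightarrow> norm z \<le> R"
    unfolding bounded_iff by blast
  have box: "- R \<le> Re (u * z) \<and> Re (u * z) \<le> R \<and> - R \<le> Im (u * z) \<and> Im (u * z) \<le> R"
    if "z \<in> path_image g \<union> H" for z
  proof -
    have "norm (u * z) \<le> R"
      using R[OF that] u by (simp add: norm_mult)
    then show ?thesis
      using abs_Re_le_cmod[of "u * z"] abs_Im_le_cmod[of "u * z"] by linarith
  qed
  have HM: "\<bar>Im (u * z)\<bar> < M" if "z \<in> H" for z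
    using M[OF that] u abs_Im_le_cmod[of "u * z"] by (simp add: norm_mult)
  have ends: "line_point u c (- M) \<in> path_image g" "line_point u c M \<in> path_image g"
    using g pathstart_in_path_image[of g] pathfinish_in_path_image[of g] by auto
  have "\<bar>c\<bar> \<le> R" "\<bar>M\<bar> \<le> R" "0 < M"
    using box[of "line_point u c M"] ends HM[OF H(3)] by (auto simp: \<gamma>)
  have bx: "- R \<le> Re (u * x)" "- R \<le> Im (u * x)" "Im (u * x) \<le> R"
      "Re (u * y) \<le> R" "- R \<le> Im (u * y)" "Im (u * y) \<le> R" "Re (u * x) \<le> R" "- R \<le> Re (u * y)"
    using box H by auto
  define Y where "Y = closed_segment (Complex c (- R)) (Complex c (- M)) \<union>
    ((*) u ` path_image g \<union> closed_segment (Complex c M) (Complex c R))"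
  define Z where "Z = closed_segment (Complex (- R) (Im (u * x))) (u * x) \<union>
    ((*) u ` H \<union> closed_segment (u * y) (Complex R (Im (u * y))))"
  have seg: "Re w \<in> closed_segment (Re p) (Re q) \<and> Im w \<in> closed_segment (Im p) (Im q)"
    if "w \<in> closed_segment p q" for p q w :: complex
    using that by (auto simp: closed_segment_def)
  have Yc: "compact Y" "connected Y"
  proof -
    have "Complex c (- M) \<in> (*) u ` path_image g" "Complex c M \<in> (*) u ` path_image g"
      using ends \<gamma> by (metis image_eqI)+
    then show "compact Y" "connected Y"
      unfolding Y_def using g(1)
      by (intro compact_Un connected_Un compact_segment connected_segment compact_continuous_image
          connected_continuous_image compact_path_image connected_path_image continuous_intros; auto)+
  qed
  have Zc: "compact Z" "connected Z"
    unfolding Z_def using H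
    by (intro compact_Un connected_Un compact_segment connected_segment compact_continuous_image
        connected_continuous_image continuous_intros; auto)+
  have "Y \<inter> Z \<noteq> {}"
  proof (rule continua_crossing_box_meet[where a = "Complex (- R) (- R)" and b = "Complex R R"
        and ?y0.0 = "Complex c (- R)" and ?y1.0 = "Complex c R"
        and ?z0.0 = "Complex (- R) (Im (u * x))" and ?z1.0 = "Complex R (Im (u * y))"])
    show "Y \<subseteq> cbox (Complex (- R) (- R)) (Complex R R)"
      unfolding Y_def
    proof (intro Un_least subsetI)
      fix w assume "w \<in> (*) u ` path_image g"
      then show "w \<in> cbox (Complex (- R) (- R)) (Complex R R)"
        using box by (auto simp: in_cbox_complex_iff)
    qed (use \<open>\<bar>c\<bar> \<le> R\<close> \<open>\<bar>M\<bar> \<le> R\<close> in \<open>auto dest!: seg simp: in_cbox_complex_iff closed_segment_eq_real_ivl split: if_splits\<close>)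
    show "Z \<subseteq> cbox (Complex (- R) (- R)) (Complex R R)"
      unfolding Z_def
    proof (intro Un_least subsetI)
      fix w assume "w \<in> (*) u ` H"
      then show "w \<in> cbox (Complex (- R) (- R)) (Complex R R)"
        using box by (auto simp: in_cbox_complex_iff)
    qed (use bx in \<open>auto dest!: seg simp: in_cbox_complex_iff closed_segment_eq_real_ivl split: if_splits\<close>)
  qed (use Yc Zc in \<open>auto simp: Y_def Z_def\<close>)
  then obtain w where w: "w \<in> Y" "w \<in> Z"
    by blast
  have wY: "a < Re w \<and> Re w < b"
    using w(1) unfolding Y_def
  proof (elim UnE)
    assume "w \<in> (*) u ` path_image g"
    then show ?thesis
      using g(2) by (auto simp: mem_strip)
  qed (use ab in \<open>auto dest!: seg\<close>)
  then have "w \<in> (*) u ` H"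
    using w(2) H(4,6) bx unfolding Z_def
    by (auto dest!: seg simp: closed_segment_eq_real_ivl split: if_splits)
  then obtain z where z: "z \<in> H" "w = u * z"
    by blast
  have "w \<in> (*) u ` path_image g"
    using w(1) HM[OF z(1)] \<open>\<bar>M\<bar> \<le> R\<close> \<open>0 < M\<close> unfolding Y_def z(2)
    by (auto dest!: seg simp: closed_segment_eq_real_ivl split: if_splits)
  then have "z \<in> path_image g"
    using z(2) \<open>u \<noteq> 0\<close> by auto
  then show False
    using disj z by blast
qed

text \<open>
  In a locally connected space the components are open and closed.
\<close>

lemma separated_by_if_not_connected_component:
  assumes lc: "locally connected (frontier X)" and C: "finite C"
    and xy: "x \<in> frontier X - C" "y \<in> frontier X - C"
    and nconn: "\<not> connected_component (frontier X - C) x y"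
  shows "separated_by X C x y"
proof -
  let ?G = "frontier X - C"
  define A where "A = connected_component_set ?G x"
  have "openin (top_of_set (frontier X)) ?G"
    using C by (metis Diff_eq finite_imp_closed open_Compl openin_open_Int)
  then have "locally connected ?G"
    using lc locally_open_subset by blast
  then have "openin (top_of_set ?G) A"
    unfolding A_def by (rule openin_connected_component_locally_connected)
  then have B: "closedin (top_of_set ?G) (?G - A)"
    by (simp add: closedin_diff)
  have A: "closedin (top_of_set ?G) A"
    unfolding A_def by (rule closedin_connected_component)
  have cl: "closure T \<inter> ?G \<subseteq> T" if T: "closedin (top_of_set ?G) T" for T
  proof -
    obtain D where D: "closed D" "T = ?G \<inter> D"
      using T unfolding closedin_closed by blast
    then have "closure T \<subseteq> D"
      by (intro closure_minimal) auto
    then show ?thesis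
      using D by blast
  qed
  have "A \<subseteq> ?G"
    by (simp add: A_def connected_component_subset)
  moreover have "x \<in> A" "y \<in> ?G - A"
    using xy nconn by (auto simp: A_def)
  ultimately show ?thesis
    unfolding separated_by_def using cl[OF A] cl[OF B] by (intro exI[of _ A] exI[of _ "?G - A"]) blast
qed

lemma finite_separator:
  assumes X: "compact X" "locally connected X"
    and lc: "locally connected (frontier X)"
    and \<U>: "finite \<U>" "\<U> \<subseteq> components (- X)" "frontier X = (\<Union>U\<in>\<U>. frontier U)"
    and xy: "x \<in> frontier X" "y \<in> frontier X" "x \<noteq> y"
  obtains C where "finite C" "C \<subseteq> frontier X" "separated_by X C x y"
proof -
  define d where "d = y - x"
  define u where "u = cnj d / norm d"
  have "norm (y - x) > 0" "norm d > 0"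
    using xy by (auto simp: d_def)
  then have u: "norm u = 1"
    by (simp add: u_def norm_divide)
  have "cnj d * d = of_real (norm d * norm d)"
    by (metis complex_norm_square mult.commute power2_eq_square)
  then have "u * d = norm d"
    using \<open>norm d > 0\<close> by (simp add: u_def)
  then have "Re (u * y) - Re (u * x) = norm (y - x)"
    unfolding d_def by (metis Re_complex_of_real minus_complex.sel(1) right_diff_distrib)
  define a where "a = Re (u * x)"
  define b where "b = Re (u * y)"
  define c where "c = (a + b) / 2"
  have c: "a < c" "c < b"
  proof -
    have "a < b"
      using \<open>Re (u * y) - Re (u * x) = norm (y - x)\<close> \<open>norm (y - x) > 0\<close> unfolding a_def b_def by linarith
    then show "a < c" "c < b"
      by (auto simp: c_def)
  qed
  have "compact (frontier X)"
    using X(1) by (rule compact_frontier)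
  have KX: "frontier X \<subseteq> X"
    using X(1) by (simp add: compact_imp_closed frontier_subset_closed)
  have "\<forall>U\<in>\<U>. \<exists>\<W>. finite \<W> \<and> (\<forall>W\<in>\<W>. W \<in> components (strip u a b - X)) \<and>
      {k \<in> frontier U. Re (u * k) = c} \<subseteq> (\<Union>W\<in>\<W>. closure W)"
  proof
    fix U assume "U \<in> \<U>"
    then have U: "U \<in> components (- X)"
      using \<U> by blast
    show "\<exists>\<W>. finite \<W> \<and> (\<forall>W\<in>\<W>. W \<in> components (strip u a b - X)) \<and>
      {k \<in> frontier U. Re (u * k) = c} \<subseteq> (\<Union>W\<in>\<W>. closure W)"
    proof (rule finite_cover_of_frontier_on_line[OF X U u c])
      fix \<W> assume "finite \<W>" "\<And>W. W \<in> \<W> \<Longrightarrow> W \<in> components (strip u a b - X) \<and> W \<subseteq> U"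
        "{k \<in> frontier U. Re (u * k) = c} \<subseteq> (\<Union>W\<in>\<W>. closure W)"
      then show ?thesis
        by (intro exI[of _ \<W>] conjI ballI) simp_all
    qed
  qed
  from bchoice[OF this] obtain w where w: "\<And>U. U \<in> \<U> \<Longrightarrow> finite (w U)"
      "\<And>U W. \<lbrakk>U \<in> \<U>; W \<in> w U\<rbrakk> \<Longrightarrow> W \<in> components (strip u a b - X)"
      "\<And>U. U \<in> \<U> \<Longrightarrow> {k \<in> frontier U. Re (u * k) = c} \<subseteq> (\<Union>W\<in>w U. closure W)"
    by blast
  define \<W> where "\<W> = (\<Union>U\<in>\<U>. w U)"
  have "finite \<W>"
    using \<U>(1) w by (auto simp: \<W>_def)
  have comp: "connected W \<and> W \<subseteq> strip u a b - frontier X" if "W \<in> \<W>" for W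
  proof -
    have "W \<in> components (strip u a b - X)"
      using that w(2) unfolding \<W>_def by blast
    then show ?thesis
      using KX in_components_connected in_components_subset by blast
  qed
  have cover: "{k \<in> frontier X. Re (u * k) = c} \<subseteq> (\<Union>W\<in>\<W>. closure W)"
  proof
    fix k assume "k \<in> {k \<in> frontier X. Re (u * k) = c}"
    then obtain U where "U \<in> \<U>" "k \<in> {k \<in> frontier U. Re (u * k) = c}"
      using \<U>(3) by blast
    then show "k \<in> (\<Union>W\<in>\<W>. closure W)"
      using w(3)[of U] unfolding \<W>_def by blast
  qed
  obtain M where M: "\<And>k. k \<in> frontier X \<Longrightarrow> norm k < M"
    using compact_imp_bounded[OF \<open>compact (frontier X)\<close>] bounded_pos_less by blast
  obtain C where C: "finite C" "C \<subseteq> {k \<in> frontier X. Re (u * k) = c}"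
    "\<forall>H. closed H \<longrightarrow> H \<subseteq> frontier X - C \<longrightarrow>
      connected_component (strip u a b - H) (line_point u c (- M)) (line_point u c M)"
    by (rule chain_along_line[OF \<open>compact (frontier X)\<close> u c \<open>finite \<W>\<close> comp cover M])
  have xyC: "x \<in> frontier X - C" "y \<in> frontier X - C"
    using xy C(2) c by (auto simp: a_def b_def)
  have "\<not> connected_component (frontier X - C) x y"
  proof
    assume conn: "connected_component (frontier X - C) x y"
    have "openin (top_of_set (frontier X)) (frontier X - C)"
      using C(1) by (metis Diff_eq finite_imp_closed open_Compl openin_open_Int)
    then obtain H where H: "compact H" "connected H" "H \<subseteq> frontier X - C" "x \<in> H" "y \<in> H"
      by (rule joined_by_continuum[OF \<open>compact (frontier X)\<close> lc _ conn])
    have "closed H"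
      using H compact_imp_closed by blast
    then have "open (strip u a b - H)"
      using open_strip by blast
    then have "path_component (strip u a b - H) (line_point u c (- M)) (line_point u c M)"
      using C(3) \<open>closed H\<close> H(3) by (simp add: open_path_connected_component)
    then obtain g where g: "path g" "path_image g \<subseteq> strip u a b - H"
        "pathstart g = line_point u c (- M)" "pathfinish g = line_point u c M"
      unfolding path_component_def by blast
    have "path_image g \<inter> H \<noteq> {}"
    proof (rule path_along_strip_meets_continuum[OF u c H(1,2,4) _ H(5) _ _ g(1) _ g(3,4)])
      show "norm z < M" if "z \<in> H" for z
        using M H(3) that by blast
    qed (use g in \<open>auto simp: a_def b_def\<close>)
    then show False
      using g(2) by blast
  qed
  then have "separated_by X C x y"
    using separated_by_if_not_connected_component[OF lc C(1) xyC] by blast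
  then show thesis
    using that C by blast
qed

section \<open>Local connectedness and the frontier\<close>

text \<open>
  The members not containing \<open>x\<close> stay away from \<open>x\<close>, and those that contain \<open>x\<close> connect their own
  nearby points to \<open>x\<close>; finiteness gives a common radius.
\<close>

lemma locally_connected_Union_compact:
  fixes \<K> :: "'a::heine_borel set set"
  assumes fin: "finite \<K>" and K: "\<And>K. K \<in> \<K> \<Longrightarrow> compact K \<and> locally connected K"
  shows "locally connected (\<Union>\<K>)"
  unfolding locally_connected_im_kleinen
proof (intro allI impI)
  fix v x assume vx: "openin (top_of_set (\<Union>\<K>)) v \<and> x \<in> v"
  then obtain e where e: "e > 0" "\<Union>\<K> \<inter> ball x e \<subseteq> v"
    unfolding openin_contains_ball by (metis Int_commute)
  have "\<exists>d>0. \<forall>y\<in>K. dist x y < d \<longrightarrow> (\<exists>c. connected c \<and> c \<subseteq> v \<and> x \<in> c \<and> y \<in> c)" if "K \<in> \<K>" for K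
  proof (cases "x \<in> K")
    case True
    obtain N d where N: "0 < d" "d \<le> e" "connected N" "N \<subseteq> K \<inter> ball x e" "K \<inter> ball x d \<subseteq> N"
      using connected_neighbourhood[of K x e] K[OF \<open>K \<in> \<K>\<close>] True e(1) by metis
    have "N \<subseteq> v" "x \<in> N"
      using N True e(2) \<open>K \<in> \<K>\<close> by auto
    then show ?thesis
      using N(1,3,5) by (intro exI[of _ d]) (auto simp: subset_iff)
  next
    case False
    then obtain d where "d > 0" "\<And>y. y \<in> K \<Longrightarrow> d \<le> dist x y"
      using separate_point_closed[of K x] K[OF \<open>K \<in> \<K>\<close>] compact_imp_closed by metis
    then show ?thesis
      by (metis not_le)
  qed
  then have "\<forall>K\<in>\<K>. \<exists>d. d > 0 \<and> (\<forall>y\<in>K. dist x y < d \<longrightarrow> (\<exists>c. connected c \<and> c \<subseteq> v \<and> x \<in> c \<and> y \<in> c))"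
    by blast
  from bchoice[OF this] obtain d where
    "\<forall>K\<in>\<K>. d K > 0 \<and> (\<forall>y\<in>K. dist x y < d K \<longrightarrow> (\<exists>c. connected c \<and> c \<subseteq> v \<and> x \<in> c \<and> y \<in> c))" ..
  then have d: "\<And>K. K \<in> \<K> \<Longrightarrow> d K > 0"
      "\<And>K y. \<lbrakk>K \<in> \<K>; y \<in> K; dist x y < d K\<rbrakk> \<Longrightarrow> \<exists>c. connected c \<and> c \<subseteq> v \<and> x \<in> c \<and> y \<in> c"
    by simp_all
  define r where "r = Min (insert e (d ` \<K>))"
  have "r > 0" "r \<le> e" and rd: "\<And>K. K \<in> \<K> \<Longrightarrow> r \<le> d K"
    using fin d(1) e(1) by (auto simp: r_def)
  have "x \<in> \<Union>\<K>"
    using vx openin_imp_subset by blast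
  show "\<exists>w. openin (top_of_set (\<Union>\<K>)) w \<and> x \<in> w \<and> w \<subseteq> v \<and>
      (\<forall>y. y \<in> w \<longrightarrow> (\<exists>c. connected c \<and> c \<subseteq> v \<and> x \<in> c \<and> y \<in> c))"
  proof (rule exI[of _ "\<Union>\<K> \<inter> ball x r"], intro conjI allI impI)
    show "\<Union>\<K> \<inter> ball x r \<subseteq> v"
      using e(2) \<open>r \<le> e\<close> by (auto simp: subset_iff)
    fix y assume "y \<in> \<Union>\<K> \<inter> ball x r"
    then obtain K where K: "K \<in> \<K>" "y \<in> K" "dist x y < r"
      by auto
    then have "dist x y < d K"
      using rd[of K] by linarith
    with K show "\<exists>c. connected c \<and> c \<subseteq> v \<and> x \<in> c \<and> y \<in> c"
      by (intro d(2))
  qed (use \<open>r > 0\<close> \<open>x \<in> \<Union>\<K>\<close> in \<open>auto intro: openin_open_Int\<close>)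
qed

text \<open>
  A point close to a frontier point \<open>x\<close> is joined to \<open>x\<close> by the segment to the nearest frontier point
  followed by a small connected subset of the frontier.
\<close>

lemma locally_connected_from_frontier:
  fixes X :: "'a::euclidean_space set"
  assumes X: "closed X" and lc: "locally connected (frontier X)"
  shows "locally connected X"
  unfolding locally_connected_im_kleinen
proof (intro allI impI)
  fix v x assume vx: "openin (top_of_set X) v \<and> x \<in> v"
  then obtain e where e: "e > 0" "X \<inter> ball x e \<subseteq> v"
    unfolding openin_contains_ball by (metis Int_commute)
  have "x \<in> X"
    using vx openin_imp_subset by blast
  have "\<exists>d>0. d \<le> e \<and> (\<forall>y\<in>X \<inter> ball x d. \<exists>c. connected c \<and> c \<subseteq> X \<inter> ball x e \<and> x \<in> c \<and> y \<in> c)"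
  proof (cases "x \<in> frontier X")
    case False
    then have "x \<in> interior X"
      using \<open>x \<in> X\<close> X by (simp add: frontier_def)
    then obtain r where "r > 0" "ball x r \<subseteq> X"
      using mem_interior by blast
    then show ?thesis
      using e(1) by (intro exI[of _ "min r e"] conjI ballI exI[of _ "ball x (min r e)"]) auto
  next
    case True
    obtain N d where N: "0 < d" "d \<le> e" "connected N" "N \<subseteq> frontier X \<inter> ball x e" "frontier X \<inter> ball x d \<subseteq> N"
      by (rule connected_neighbourhood[OF lc True e(1)])
    have "\<exists>c. connected c \<and> c \<subseteq> X \<inter> ball x e \<and> x \<in> c \<and> y \<in> c" if y: "y \<in> X" "dist x y < d / 2" for y
    proof -
      obtain z where z: "z \<in> frontier X" "\<And>z'. z' \<in> frontier X \<Longrightarrow> dist y z \<le> dist y z'"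
        using distance_attains_inf[of "frontier X" y] True by (metis empty_iff frontier_closed)
      have yz: "dist y z < d / 2"
        using z(2)[OF True] y(2) by (simp add: dist_commute)
      have seg_ball: "closed_segment y z \<subseteq> ball x d"
      proof
        fix w assume "w \<in> closed_segment y z"
        then have "dist y w < d / 2"
          using yz dist_in_closed_segment[of w y z] by (simp add: dist_commute)
        then show "w \<in> ball x d"
          using y(2) dist_triangle[of x w y] by simp
      qed
      then have "z \<in> N"
        using N(5) z(1) by auto
      have "closed_segment y z \<subseteq> X"
      proof
        fix w assume w: "w \<in> closed_segment y z"
        show "w \<in> X"
        proof (cases "w = y \<or> w = z")
          case True
          then show ?thesis
            using y(1) z(1) X frontier_subset_closed by blast
        next
          case False
          then have "dist y w < dist y z"
            using w dist_in_open_segment[of w y z] by (simp add: open_segment_def dist_commute)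
          moreover have "ball y (dist y z) \<inter> frontier X = {}"
            using z(2) by force
          moreover have "0 < dist y z"
            using \<open>dist y w < dist y z\<close> zero_le_dist[of y w] by linarith
          then have "y \<in> ball y (dist y z)"
            by (simp only: centre_in_ball)
          ultimately have "ball y (dist y z) - X = {}"
            using connected_Int_frontier[OF connected_ball, of y "dist y z" X] y(1) by blast
          then show ?thesis
            using \<open>dist y w < dist y z\<close> by auto
        qed
      qed
      have "connected (N \<union> closed_segment y z)"
        using \<open>z \<in> N\<close> N(3) by (intro connected_Un connected_segment) auto
      moreover have "N \<union> closed_segment y z \<subseteq> X \<inter> ball x e"
        using N(4) seg_ball subset_ball[OF N(2), of x] \<open>closed_segment y z \<subseteq> X\<close> frontier_subset_closed[OF X]
        by blast
      moreover have "x \<in> N"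
        using N(1,5) True by auto
      ultimately show ?thesis
        by (intro exI[of _ "N \<union> closed_segment y z"]) auto
    qed
    then show ?thesis
      using N(1,2) by (intro exI[of _ "d / 2"]) auto
  qed
  then obtain d where d: "d > 0" "d \<le> e"
      "\<And>y. y \<in> X \<inter> ball x d \<Longrightarrow> \<exists>c. connected c \<and> c \<subseteq> X \<inter> ball x e \<and> x \<in> c \<and> y \<in> c"
    by blast
  show "\<exists>w. openin (top_of_set X) w \<and> x \<in> w \<and> w \<subseteq> v \<and>
      (\<forall>y. y \<in> w \<longrightarrow> (\<exists>c. connected c \<and> c \<subseteq> v \<and> x \<in> c \<and> y \<in> c))"
  proof (rule exI[of _ "X \<inter> ball x d"], intro conjI allI impI)
    show "X \<inter> ball x d \<subseteq> v"
      using e(2) d(2) by (auto simp: subset_iff)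
    show "\<exists>c. connected c \<and> c \<subseteq> v \<and> x \<in> c \<and> y \<in> c" if "y \<in> X \<inter> ball x d" for y
      using d(3)[OF that] e(2) by blast
  qed (use d(1) \<open>x \<in> X\<close> in \<open>auto intro: openin_open_Int\<close>)
qed

lemma frontier_eq_Union_component_frontiers:
  fixes X :: "'a::euclidean_space set"
  assumes X: "closed X" and fin: "finite (components (- X))"
  shows "frontier X = (\<Union>U\<in>components (- X). frontier U)"
proof
  show "(\<Union>U\<in>components (- X). frontier U) \<subseteq> frontier X"
    by (intro UN_least) (metis frontier_complement frontier_of_components_subset)
  show "frontier X \<subseteq> (\<Union>U\<in>components (- X). frontier U)"
  proof
    fix x assume x: "x \<in> frontier X"
    have "- X \<subseteq> (\<Union>U\<in>components (- X). closure U)"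
      using Union_components[of "- X"] closure_subset by blast
    then have "closure (- X) \<subseteq> (\<Union>U\<in>components (- X). closure U)"
      using fin by (intro closure_minimal closed_UN) auto
    moreover have "x \<in> closure (- X)"
      using x by (simp add: frontier_closures)
    ultimately obtain U where U: "U \<in> components (- X)" "x \<in> closure U"
      by blast
    have "x \<notin> U"
      using x X frontier_subset_closed in_components_subset[OF U(1)] by blast
    then have "x \<in> frontier U"
      using U(2) interior_subset by (auto simp: frontier_def)
    then show "x \<in> (\<Union>U\<in>components (- X). frontier U)"
      using U(1) by blast
  qed
qed

text \<open>
  The frontier of an open set has empty interior.
\<close>

lemma unshielded_frontier:
  fixes X :: "'a::euclidean_space set"
  assumes "compact X" "U \<in> components (- X)" "X = frontier U"
  shows "frontier X = frontier U"
proof -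
  have "open U"
    using assms(1,2) open_components[of "- X"] by (auto simp: compact_imp_closed open_Compl)
  have "interior X = {}"
  proof -
    have "U \<inter> interior (frontier U) = {}"
      using \<open>open U\<close> interior_subset[of "frontier U"] by (auto simp: frontier_def interior_open)
    then have "closure U \<inter> interior (frontier U) = {}"
      using open_Int_closure_eq_empty[OF open_interior] by blast
    then show ?thesis
      using assms(3) interior_subset[of "frontier U"] by (auto simp: frontier_def)
  qed
  then show ?thesis
    using assms by (metis Diff_empty closure_closed compact_imp_closed frontier_def)
qed

section \<open>Fibers and scale\<close>

lemma mem_fiber_self:
  assumes "closed X" "x \<in> X"
  shows "x \<in> fiber X x"
proof -
  have "\<not> separated_by X C x x" for C
    using closure_subset by (auto simp: separated_by_def)
  then have "x \<in> pseudo_fiber X x"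
    using assms by (auto simp: pseudo_fiber_def frontier_def)
  then show ?thesis
    by (simp add: fiber_def)
qed

lemma fiber_subset:
  assumes "closed X" "x \<in> X"
  shows "fiber X x \<subseteq> X"
proof -
  have "pseudo_fiber X x \<subseteq> X"
    using assms frontier_subset_closed by (auto simp: pseudo_fiber_def)
  then show ?thesis
    using connected_component_subset by (fastforce simp: fiber_def)
qed

text \<open>
  Scale \<open>0\<close> allows chains of at most one step.  A chain without steps means \<open>X = {x}\<close>; in a chain with
  one step \<open>{x}\<close> is a fiber, and its base point can only be \<open>x\<close>.
\<close>

lemma local_scale_eq_0_iff:
  assumes X: "continuum X" and x: "x \<in> X"
  shows "local_scale X x = 0 \<longleftrightarrow> fiber X x = {x}"
proof -
  define P where "P p \<longleftrightarrow> (\<exists>k N. k \<le> p + 1 \<and> fiber_chain X x k N)" for p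
  have "closed X"
    using X by (simp add: continuum_def compact_imp_closed)
  have scale: "local_scale X x = (if \<exists>p. P p then enat (LEAST p. P p) else \<infinity>)"
    unfolding local_scale_def P_def by simp
  have "local_scale X x = 0 \<longleftrightarrow> P 0"
  proof
    assume "local_scale X x = 0"
    then have "\<exists>p. P p" "(LEAST p. P p) = 0"
      by (auto simp: scale zero_enat_def split: if_splits)
    then show "P 0"
      using LeastI_ex[of P] by simp
  next
    assume "P 0"
    then have "\<exists>p. P p" "(LEAST p. P p) = 0"
      by (blast, simp add: Least_eq_0)
    then show "local_scale X x = 0"
      by (simp add: scale zero_enat_def)
  qed
  also have "P 0 \<longleftrightarrow> fiber X x = {x}"
  proof
    assume "P 0"
    then obtain k N where k: "k \<le> 1" and N: "fiber_chain X x k N"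
      by (auto simp: P_def)
    show "fiber X x = {x}"
    proof (cases "k = 0")
      case True
      then have "X = {x}"
        using N by (auto simp: fiber_chain_def)
      then show ?thesis
        using mem_fiber_self[OF \<open>closed X\<close> x] fiber_subset[OF \<open>closed X\<close> x] by auto
    next
      case False
      then have "k = 1"
        using k by simp
      then have "is_fiber_of {x} X"
        using N by (auto simp: fiber_chain_def)
      then obtain y where y: "y \<in> X" "{x} = fiber X y"
        unfolding is_fiber_of_def by blast
      have "y \<in> {x}"
        unfolding y(2) using \<open>closed X\<close> y(1) by (rule mem_fiber_self)
      then have "y = x"
        by simp
      then show ?thesis
        using y(2) by simp
    qed
  next
    assume "fiber X x = {x}"
    then have "fiber_chain X x 1 (\<lambda>i. if i = 0 then X else {x})"
      using X x by (auto simp: fiber_chain_def is_fiber_of_def continuum_def)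
    then show "P 0"
      unfolding P_def by (metis add_0 order_refl)
  qed
  finally show ?thesis .
qed

lemma global_scale_eq_0_iff:
  assumes "continuum X"
  shows "global_scale X = 0 \<longleftrightarrow> (\<forall>x\<in>X. fiber X x = {x})"
proof -
  have "global_scale X = 0 \<longleftrightarrow> (\<forall>x\<in>X. local_scale X x = 0)"
    unfolding global_scale_def bot_enat_def[symmetric] by (rule SUP_bot_conv)
  then show ?thesis
    using local_scale_eq_0_iff[OF assms] by blast
qed

theorem mainTheorem4:
  fixes X :: "complex set"
  assumes "continuum X"
    and "unshielded X \<or> finite (components (- X))"
  shows "locally connected X \<longleftrightarrow> global_scale X = 0"
proof -
  have X: "compact X" "connected X" "closed X"
    using assms(1) by (auto simp: continuum_def compact_imp_closed)
  obtain \<U> where \<U>: "finite \<U>" "\<U> \<subseteq> components (- X)" "frontier X = (\<Union>U\<in>\<U>. frontier U)"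
  proof (cases "finite (components (- X))")
    case True
    then show thesis
      using that[of "components (- X)"] frontier_eq_Union_component_frontiers[OF X(3)] by blast
  next
    case False
    then obtain U where "U \<in> components (- X)" "X = frontier U"
      using assms(2) by (auto simp: unshielded_def)
    then show thesis
      using that[of "{U}"] unshielded_frontier[OF X(1)] by simp
  qed
  have K: "compact (frontier U)" "connected (frontier U)" "frontier U \<subseteq> frontier X" if "U \<in> \<U>" for U
  proof -
    show *: "frontier U \<subseteq> frontier X"
      using \<U>(3) that by blast
    then show "compact (frontier U)"
      using compact_frontier[OF X(1)] by (metis closed_Int_compact frontier_closed inf.absorb1)
    show "connected (frontier U)"
      using \<U>(2) that by (intro connected_frontier_component_complement[OF X(2)]) auto
  qed
  have frontier_lc: "locally connected (frontier X)" if "\<And>U. U \<in> \<U> \<Longrightarrow> locally connected (frontier U)"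
    unfolding \<U>(3) using K(1) \<U>(1) that by (intro locally_connected_Union_compact) auto
  have "(\<forall>x\<in>X. fiber X x = {x}) \<longleftrightarrow> locally connected X"
  proof
    assume trivial: "\<forall>x\<in>X. fiber X x = {x}"
    have "locally connected (frontier U)" if U: "U \<in> \<U>" for U
    proof (rule ccontr)
      assume nlc: "\<not> locally connected (frontier U)"
      obtain u a b \<Q> where cross: "norm u = 1" "a < b" "infinite \<Q>" "pairwise disjnt \<Q>"
          "\<And>Q. Q \<in> \<Q> \<Longrightarrow> Q \<subseteq> frontier U \<and> crosses u a b Q"
        using infinitely_many_crossings[OF K(1,2)[OF U] nlc] by metis
      obtain x y L where L: "connected L" "L \<subseteq> frontier U" "x \<in> L" "y \<in> L" "x \<noteq> y"
          "\<And>Y C w. \<lbrakk>finite C; frontier U \<subseteq> frontier Y; w \<in> L\<rbrakk> \<Longrightarrow> \<not> separated_by Y C x w"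
        using limit_continuum_inseparable[OF K(1)[OF U] cross(2-5)] by metis
      have LX: "L \<subseteq> frontier X"
        using L(2) K(3)[OF U] by blast
      then have "x \<in> X" "x \<notin> interior X"
        using L(3) X(3) frontier_subset_closed by (auto simp: frontier_def)
      have "L \<subseteq> pseudo_fiber X x"
        using LX L(6)[OF _ K(3)[OF U]] \<open>x \<notin> interior X\<close> by (auto simp: pseudo_fiber_def)
      then have "L \<subseteq> fiber X x"
        unfolding fiber_def using L(1,3) by (intro connected_component_maximal)
      then show False
        using trivial \<open>x \<in> X\<close> L(3,4,5) by auto
    qed
    then show "locally connected X"
      using locally_connected_from_frontier[OF X(3)] frontier_lc by blast
  next
    assume lc: "locally connected X"
    have "locally connected (frontier U)" if "U \<in> \<U>" for U
      using Torhorst[OF X(1,2) lc] \<U>(2) that by blast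
    then have flc: "locally connected (frontier X)"
      by (rule frontier_lc)
    show "\<forall>x\<in>X. fiber X x = {x}"
    proof
      fix x assume x: "x \<in> X"
      have "pseudo_fiber X x \<subseteq> {x}"
      proof (cases "x \<in> interior X")
        case True
        then show ?thesis
          by (simp add: pseudo_fiber_def)
      next
        case False
        then have xf: "x \<in> frontier X"
          using x X(3) by (simp add: frontier_def)
        have "\<exists>C. finite C \<and> C \<subseteq> frontier X \<and> separated_by X C x y" if "y \<in> frontier X" "x \<noteq> y" for y
          using finite_separator[OF X(1) lc flc \<U> xf that] by metis
        then show ?thesis
          using False by (auto simp: pseudo_fiber_def)
      qed
      then have "fiber X x \<subseteq> {x}"
        unfolding fiber_def using connected_component_subset by blast
      then show "fiber X x = {x}"
        using mem_fiber_self[OF X(3) x] by blast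
    qed
  qed
  then show ?thesis
    using global_scale_eq_0_iff[OF assms(1)] by blast
qed

end
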